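(* Let $(\mathcal H,[\cdot,\cdot])$ be a Krein space, let $B\in CR(\mathcal H)$ and suppose that $N(B)$ and $R(B)$ are uniformly positive. Then the Moore-Penrose inverse $B^\dagger$ of $B$ is the unique indefinite minimum solution (ImS) $X_0$ of $BX-I=0$ such that $X_0^{\#}X_0\le Y^{\#}Y$ for every ImS $Y$ of $BX-I=0$.
   Context: A Krein space is a complex vector space $\mathcal H$ with a Hermitian sesquilinear form $[\cdot,\cdot]$ admitting a fundamental decomposition $\mathcal H=\mathcal H_+[\dotplus]\mathcal H_-$ (direct and $[\cdot,\cdot]$-orthogonal) with $(\mathcal H_+,[\cdot,\cdot])$ and $(\mathcal H_-,-[\cdot,\cdot])$ (separable) Hilbert spaces; the direct sum of these Hilbert spaces gives a Hilbert space norm $\|\cdot\|$ on $\mathcal H$, and all such norms are equivalent. $L(\mathcal H)$ is the space of linear operators on $\mathcal H$ bounded with respect to such a norm; $CR(\mathcal H)$ is the set of those with closed range. $R(A)$, $N(A)$ are the range and null space of $A$. For $T\in L(\mathcal H)$, $T^{\#}$ is the unique operator with $[Tx,y]=[x,T^{\#}y]$ for all $x,y$. For $S,T\in L(\mathcal H)$, $S\le T$ means $[(T-S)x,x]\ge 0$ for all $x\in\mathcal H$. A subspace $\mathcal S$ is uniformly positive if there is $\varepsilon>0$ with $[s,s]\ge\varepsilon\|s\|^2$ for all $s\in\mathcal S$ (for some such Hilbert norm). An operator $X_0\in L(\mathcal H)$ is an indefinite minimum solution (ImS) of $BX-I=0$ if $(BX_0-I)^{\#}(BX_0-I)\le (BX-I)^{\#}(BX-I)$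 for every $X\in L(\mathcal H)$. The Moore-Penrose inverse of $B$ is the operator $B^\dagger\in L(\mathcal H)$ with $BB^\dagger B=B$, $B^\dagger BB^\dagger=B^\dagger$, $(BB^\dagger)^{\#}=BB^\dagger$ and $(B^\dagger B)^{\#}=B^\dagger B$. A known theorem of X. Mary says that such an operator exists (and is then unique) if and only if $R(B)$ and $N(B)$ are regular subspaces (a closed subspace $\mathcal S$ is regular if $\mathcal H=\mathcal S[\dotplus]\mathcal S^{[\perp]}$, where $\mathcal S^{[\perp]}=\{x:[x,s]=0\ \forall s\in\mathcal S\}$); closed uniformly positive subspaces are regular. *)

theory Defs
  imports "HOL-Analysis.Analysis"
begin

text \<open>
  The space is the whole type \<open>'a\<close>, with an arbitrary complex vector space structure \<open>cscale\<close>
  in the sense of the locale \<^locale>\<open>vector_space\<close>; forms are linear in the first and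
  conjugate linear in the second argument.
\<close>

definition hermitian_form_on ::
  "(complex \<Rightarrow> 'a::ab_group_add \<Rightarrow> 'a) \<Rightarrow> 'a set \<Rightarrow> ('a \<Rightarrow> 'a \<Rightarrow> complex) \<Rightarrow> bool" where
  "hermitian_form_on cscale S g \<longleftrightarrow>
     (\<forall>x\<in>S. \<forall>y\<in>S. \<forall>z\<in>S. g (x + y) z = g x z + g y z) \<and>
     (\<forall>c. \<forall>x\<in>S. \<forall>y\<in>S. g (cscale c x) y = c * g x y) \<and>
     (\<forall>x\<in>S. \<forall>y\<in>S. g y x = cnj (g x y))"

text \<open>
  On a subspace where \<open>g\<close> is positive definite, \<open>cmod (g x x)\<close> is just \<open>g x x\<close>.  The modulus
  keeps the distance nonnegative off that subspace too, as \<^locale>\<open>Metric_space\<close> demands of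
  all arguments, not only of those in the carrier.
\<close>

definition form_norm :: "('a \<Rightarrow> 'a \<Rightarrow> complex) \<Rightarrow> 'a \<Rightarrow> real" where
  "form_norm g x = sqrt (cmod (g x x))"

definition form_dist :: "('a::ab_group_add \<Rightarrow> 'a \<Rightarrow> complex) \<Rightarrow> 'a \<Rightarrow> 'a \<Rightarrow> real" where
  "form_dist g x y = form_norm g (x - y)"

definition separable_hilbert_on ::
  "(complex \<Rightarrow> 'a::ab_group_add \<Rightarrow> 'a) \<Rightarrow> 'a set \<Rightarrow> ('a \<Rightarrow> 'a \<Rightarrow> complex) \<Rightarrow> bool" where
  "separable_hilbert_on cscale S g \<longleftrightarrow>
     module.subspace cscale S \<and>
     hermitian_form_on cscale S g \<and>
     (\<forall>x\<in>S. g x x \<in> \<real>\<^sub>\<ge>\<^sub>0 \<and> (g x x = 0 \<longrightarrow> x = 0)) \<and>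
     Metric_space.mcomplete S (form_dist g) \<and>
     separable_space (Metric_space.mtopology S (form_dist g))"

locale hermitian_space = vector_space cscale
  for cscale :: "complex \<Rightarrow> 'a::ab_group_add \<Rightarrow> 'a" +
  fixes form :: "'a \<Rightarrow> 'a \<Rightarrow> complex"
  assumes hermitian: "hermitian_form_on cscale UNIV form"
begin

definition fundamental_decomposition :: "'a set \<Rightarrow> 'a set \<Rightarrow> bool" where
  "fundamental_decomposition P M \<longleftrightarrow>
     separable_hilbert_on cscale P form \<and>
     separable_hilbert_on cscale M (\<lambda>x y. - form x y) \<and>
     (\<forall>x. \<exists>u\<in>P. \<exists>v\<in>M. x = u + v) \<and>
     P \<inter> M = {0} \<and>
     (\<forall>u\<in>P. \<forall>v\<in>M. form u v = 0)"

definition component :: "'a set \<Rightarrow> 'a set \<Rightarrow> 'a \<Rightarrow> 'a" where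
  "component U V x = (THE u. u \<in> U \<and> x - u \<in> V)"

text \<open>The inner product of the direct sum of the Hilbert spaces \<open>(P, form)\<close> and \<open>(M, -form)\<close>.\<close>

definition fd_inner :: "'a set \<Rightarrow> 'a set \<Rightarrow> 'a \<Rightarrow> 'a \<Rightarrow> complex" where
  "fd_inner P M x y =
     form (component P M x) (component P M y) - form (component M P x) (component M P y)"

definition fd_norm :: "'a set \<Rightarrow> 'a set \<Rightarrow> 'a \<Rightarrow> real" where
  "fd_norm P M = form_norm (fd_inner P M)"

definition fd_topology :: "'a set \<Rightarrow> 'a set \<Rightarrow> 'a topology" where
  "fd_topology P M = Metric_space.mtopology UNIV (form_dist (fd_inner P M))"

text \<open>
  In a Krein space the norms of any two fundamental decompositions are equivalent, so the
  choice of \<open>(P, M)\<close> in the following three definitions is immaterial.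
\<close>

definition bounded_ops :: "('a \<Rightarrow> 'a) set" where
  "bounded_ops = {T. Vector_Spaces.linear cscale cscale T \<and>
     (\<exists>P M. fundamental_decomposition P M \<and> (\<exists>C. \<forall>x. fd_norm P M (T x) \<le> C * fd_norm P M x))}"

definition closed_range_ops :: "('a \<Rightarrow> 'a) set" where
  "closed_range_ops = {T \<in> bounded_ops.
     \<exists>P M. fundamental_decomposition P M \<and> closedin (fd_topology P M) (range T)}"

definition uniformly_positive :: "'a set \<Rightarrow> bool" where
  "uniformly_positive S \<longleftrightarrow> subspace S \<and>
     (\<exists>P M. fundamental_decomposition P M \<and>
       (\<exists>\<epsilon>>0. \<forall>s\<in>S. Re (form s s) \<ge> \<epsilon> * (fd_norm P M s)\<^sup>2))"

definition adj :: "('a \<Rightarrow> 'a) \<Rightarrow> 'a \<Rightarrow> 'a" where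
  "adj T = (THE S. S \<in> bounded_ops \<and> (\<forall>x y. form (T x) y = form x (S y)))"

definition op_le :: "('a \<Rightarrow> 'a) \<Rightarrow> ('a \<Rightarrow> 'a) \<Rightarrow> bool" where
  "op_le S T \<longleftrightarrow> (\<forall>x. form (T x - S x) x \<in> \<real>\<^sub>\<ge>\<^sub>0)"

definition gram :: "('a \<Rightarrow> 'a) \<Rightarrow> 'a \<Rightarrow> 'a" where
  "gram T = adj T \<circ> T"

definition indefinite_min_solution :: "('a \<Rightarrow> 'a) \<Rightarrow> ('a \<Rightarrow> 'a) \<Rightarrow> bool" where
  "indefinite_min_solution B X0 \<longleftrightarrow> X0 \<in> bounded_ops \<and>
     (\<forall>X\<in>bounded_ops. op_le (gram (\<lambda>x. B (X0 x) - x)) (gram (\<lambda>x. B (X x) - x)))"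

definition is_moore_penrose_inverse :: "('a \<Rightarrow> 'a) \<Rightarrow> ('a \<Rightarrow> 'a) \<Rightarrow> bool" where
  "is_moore_penrose_inverse B D \<longleftrightarrow> D \<in> bounded_ops \<and>
     B \<circ> D \<circ> B = B \<and> D \<circ> B \<circ> D = D \<and>
     adj (B \<circ> D) = B \<circ> D \<and> adj (D \<circ> B) = D \<circ> B"

definition moore_penrose_inverse :: "('a \<Rightarrow> 'a) \<Rightarrow> 'a \<Rightarrow> 'a" where
  "moore_penrose_inverse B = (THE D. is_moore_penrose_inverse B D)"

end

locale krein_space = hermitian_space cscale form
  for cscale :: "complex \<Rightarrow> 'a::ab_group_add \<Rightarrow> 'a" and form :: "'a \<Rightarrow> 'a \<Rightarrow> complex" +
  assumes ex_fundamental_decomposition: "\<exists>P M. fundamental_decomposition P M"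

end

theory Submission
  imports Defs
begin

text \<open>
  Riesz representation in the Hilbert spaces \<open>R(B)\<close> and \<open>N(B)\<close> (with the form itself as inner
  product) gives self-adjoint projections onto them. Inverting \<open>B\<close> between \<open>N(B)\<^sup>\<bottom>\<close> and \<open>R(B)\<close> after
  projecting onto \<open>R(B)\<close> yields \<open>D\<close>, bounded by the closed graph theorem. Then \<open>B X - I\<close> splits
  orthogonally into \<open>B X - B D\<close>, with values in the positive subspace \<open>R(B)\<close>, and \<open>B D - I\<close>; so \<open>X\<close> is
  an ImS iff \<open>B X = B D\<close>. For such \<open>X\<close> the difference \<open>X - D\<close> has values in the positive subspace \<open>N(B)\<close>
  and is orthogonal to \<open>D\<close>, so \<open>X\<^sup>#X\<close> is least exactly for \<open>X = D\<close>.
\<close>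

section \<open>Complete norms and the closed graph theorem\<close>

text \<open>The type carries no topology of its own and no canonical norm: boundedness, closed range
  and uniform positivity may each be witnessed by a different fundamental decomposition. Norms are
  therefore plain functions, and every hypothesis is first moved to one fixed decomposition. This
  transfer is the closed graph theorem for the identity map, whose graph is closed because the form
  is nondegenerate and continuous for each of these norms. Riesz representation is stated for any
  subspace complete under its own form, since it serves two settings: the whole space with
  \<open>fd_inner\<close>, giving adjoints, and \<open>R(B)\<close>, \<open>N(B)\<close> with the
  form itself, giving projections. The algebra rests on two equations for \<open>D\<close>:
  \<open>[By, BDx] = [By, x]\<close>, and \<open>[n, Dx] = 0\<close> for \<open>n\<close> in
  \<open>N(B)\<close>. Vectors of \<open>R(B)\<close> or \<open>N(B)\<close> are shown to vanish by
  proving that their square is nonpositive.\<close>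

locale complex_norm = vector_space cscale
  for cscale :: "complex \<Rightarrow> 'a::ab_group_add \<Rightarrow> 'a" +
  fixes nrm :: "'a \<Rightarrow> real"
  assumes nrm_triangle: "nrm (x + y) \<le> nrm x + nrm y"
    and nrm_scale: "nrm (cscale c x) = cmod c * nrm x"
    and nrm_eq_0: "nrm x = 0 \<Longrightarrow> x = 0"
begin

lemma nrm_0 [simp]: "nrm 0 = 0"
  using nrm_scale[of 0 0] by simp

lemma nrm_minus: "nrm (- x) = nrm x"
  using nrm_scale[of "- 1" x] by simp

lemma nrm_commute: "nrm (x - y) = nrm (y - x)"
  using nrm_minus[of "x - y"] by simp

lemma nrm_ge_0 [simp]: "0 \<le> nrm x"
  using nrm_triangle[of x "- x"] by (simp add: nrm_minus)

lemma nrm_triangle': "nrm (x - z) \<le> nrm (x - y) + nrm (y - z)"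
  using nrm_triangle[of "x - y" "y - z"] by simp

lemma nrm_sub_le: "nrm x \<le> nrm y + nrm (x - y)"
  using nrm_triangle[of y "x - y"] by simp

lemma nrm_diff_le: "nrm (x - y) \<le> nrm x + nrm y"
  using nrm_triangle[of x "- y"] by (simp add: nrm_minus)

sublocale Metric_space UNIV "\<lambda>x y. nrm (x - y)"
  by unfold_locales (auto simp: nrm_commute dest: nrm_eq_0 intro: nrm_triangle')

lemma limitin_iff: "limitin mtopology s x sequentially \<longleftrightarrow> (\<lambda>n. nrm (s n - x)) \<longlonglongrightarrow> 0"
  by (simp add: limit_metric_sequentially LIMSEQ_iff)

lemma limit_unique:
  assumes "(\<lambda>n. nrm (s n - x)) \<longlonglongrightarrow> 0" "(\<lambda>n. nrm (s n - y)) \<longlonglongrightarrow> 0"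
  shows "x = y"
  using assms limitin_metric_unique[of s x sequentially y] by (simp add: limitin_iff)

lemma nrm_le_limit:
  assumes "(\<lambda>n. nrm (s n - x)) \<longlonglongrightarrow> 0" "\<And>n. nrm (s n) \<le> c"
  shows "nrm x \<le> c"
proof -
  have "(\<lambda>n. c + nrm (s n - x)) \<longlonglongrightarrow> c + 0"
    by (intro tendsto_intros assms)
  moreover have "nrm x \<le> c + nrm (s n - x)" for n
    using nrm_sub_le[of x "s n"] assms(2)[of n] nrm_commute[of x "s n"] by linarith
  ultimately show ?thesis
    using LIMSEQ_le_const[of _ "c + 0" "nrm x"] by auto
qed

end

locale complete_norm = complex_norm +
  assumes complete: mcomplete
begin

lemma cauchy_convergent:
  assumes "\<And>e. 0 < e \<Longrightarrow> \<exists>K. \<forall>m\<ge>K. \<forall>n\<ge>K. nrm (s m - s n) < e"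
  shows "\<exists>x. (\<lambda>n. nrm (s n - x)) \<longlonglongrightarrow> 0"
  using complete assms unfolding mcomplete_def MCauchy_def limitin_iff by blast

text \<open>Completeness in the form that successive approximation needs: besides the limit it
  yields the explicit bound \<open>2 * c\<close>, which later becomes an operator bound.\<close>

lemma geometric_convergent:
  assumes step: "\<And>n. nrm (s (Suc n) - s n) \<le> c / 2 ^ n"
  obtains x where "(\<lambda>n. nrm (s n - x)) \<longlonglongrightarrow> 0" "nrm (x - s 0) \<le> 2 * c"
proof -
  have c: "0 \<le> c"
    using order_trans[OF nrm_ge_0 step[of 0]] by simp
  \<comment> \<open>The right-hand side is the exact value of the geometric sum of
    \<open>c / 2 ^ j\<close> for \<open>j\<close> from \<open>m\<close> to \<open>m + k - 1\<close>,
    so the induction closes without slack.\<close>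
  have "nrm (s (m + k) - s m) \<le> 2 * c / 2 ^ m - 2 * c / 2 ^ (m + k)" for m k
  proof (induction k)
    case (Suc k)
    have "nrm (s (m + Suc k) - s m) \<le> nrm (s (m + Suc k) - s (m + k)) + nrm (s (m + k) - s m)"
      by (rule nrm_triangle')
    also have "\<dots> \<le> c / 2 ^ (m + k) + (2 * c / 2 ^ m - 2 * c / 2 ^ (m + k))"
      using Suc step[of "m + k"] by simp
    also have "\<dots> = 2 * c / 2 ^ m - 2 * c / 2 ^ (m + Suc k)"
      by (simp add: field_simps)
    finally show ?case .
  qed simp
  then have tail: "nrm (s (m + k) - s m) \<le> 2 * c / 2 ^ m" for m k
    by (rule order_trans) (use c in simp)
  have "\<exists>x. (\<lambda>n. nrm (s n - x)) \<longlonglongrightarrow> 0"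
  proof (rule cauchy_convergent)
    fix e :: real assume "0 < e"
    \<comment> \<open>Twice the tail bound: both \<open>s m\<close> and \<open>s n\<close> are
      compared with \<open>s K\<close>.\<close>
    have "(\<lambda>n. 4 * c * (1 / 2) ^ n) \<longlonglongrightarrow> 4 * c * 0"
      by (intro tendsto_mult tendsto_const LIMSEQ_power_zero) simp
    then have "\<forall>\<^sub>F n in sequentially. 4 * c * (1 / 2) ^ n < e"
      using \<open>0 < e\<close> order_tendstoD(2) by fastforce
    then obtain K where K: "4 * c * (1 / 2) ^ K < e"
      using eventually_happens trivial_limit_sequentially by blast
    have "nrm (s m - s n) < e" if "m \<ge> K" "n \<ge> K" for m n
    proof -
      have "nrm (s m - s n) \<le> nrm (s m - s K) + nrm (s n - s K)"
        using nrm_triangle'[of "s m" "s n" "s K"] nrm_commute[of "s K" "s n"] by simp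
      also have "\<dots> \<le> 4 * c * (1 / 2) ^ K"
        using tail[of K "m - K"] tail[of K "n - K"] that by (simp add: power_one_over field_simps)
      finally show ?thesis using K by simp
    qed
    then show "\<exists>K. \<forall>m\<ge>K. \<forall>n\<ge>K. nrm (s m - s n) < e" by blast
  qed
  then obtain x where x: "(\<lambda>n. nrm (s n - x)) \<longlonglongrightarrow> 0" ..
  have "nrm (x - s 0) \<le> 2 * c"
  proof (rule nrm_le_limit)
    show "(\<lambda>n. nrm ((s n - s 0) - (x - s 0))) \<longlonglongrightarrow> 0"
      using x by simp
    show "nrm (s n - s 0) \<le> 2 * c" for n
      using tail[of 0 n] by simp
  qed
  with x show ?thesis by (rule that)
qed

text \<open>The Baire category theorem for sets that need not be closed: one of the closures has
  interior, that is, one of the sets is dense in some ball.\<close>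

lemma baire_cover:
  fixes A :: "nat \<Rightarrow> 'a set"
  assumes "(\<Union>n. A n) = UNIV"
  obtains n a r where "0 < r" "\<forall>x. nrm (x - a) < r \<longrightarrow> (\<forall>e>0. \<exists>y\<in>A n. nrm (x - y) < e)"
proof -
  have "\<exists>n. mtopology interior_of (mtopology closure_of A n) \<noteq> {}"
  proof (rule ccontr)
    assume "\<not> ?thesis"
    then have "mtopology interior_of \<Union> (range (\<lambda>n. mtopology closure_of A n)) = {}"
      by (intro metric_Baire_category_alt complete) auto
    moreover have "(\<Union>n. mtopology closure_of A n) = UNIV"
      using assms closure_of_subset[of "A _" mtopology] by fastforce
    ultimately show False
      using interior_of_topspace[of mtopology] by simp
  qed
  then obtain n a where "a \<in> mtopology interior_of (mtopology closure_of A n)"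
    by blast
  then obtain r where "0 < r" and r: "mball a r \<subseteq> mtopology closure_of A n"
    by (auto simp: metric_interior_of)
  show ?thesis
  proof
    show "0 < r" by fact
    show "\<forall>x. nrm (x - a) < r \<longrightarrow> (\<forall>e>0. \<exists>y\<in>A n. nrm (x - y) < e)"
    proof (intro allI impI)
      fix x and e :: real assume "nrm (x - a) < r" "0 < e"
      then have "x \<in> mtopology closure_of A n"
        using r by (auto simp: nrm_commute)
      then show "\<exists>y\<in>A n. nrm (x - y) < e"
        using \<open>0 < e\<close> by (auto simp: metric_closure_of)
    qed
  qed
qed

end

text \<open>By Baire, a sublevel set of \<open>nrm2 (T x)\<close> is dense in a ball. Translation
  and scaling turn this into approximation of any \<open>x\<close> by vectors with controlled image.
  Summing the approximations of the successive errors gives a sequence tending to \<open>x\<close>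
  whose images converge with a bound, and closedness identifies their limit as
  \<open>T x\<close>.\<close>

theorem closed_graph:
  fixes T :: "'a::ab_group_add \<Rightarrow> 'b::ab_group_add"
  assumes "complete_norm s1 nrm1" "complete_norm s2 nrm2"
    and "Vector_Spaces.linear s1 s2 T"
    and closed: "\<And>s x y. \<lbrakk>(\<lambda>n. nrm1 (s n - x)) \<longlonglongrightarrow> 0; (\<lambda>n. nrm2 (T (s n) - y)) \<longlonglongrightarrow> 0\<rbrakk> \<Longrightarrow> T x = y"
  shows "\<exists>C. \<forall>x. nrm2 (T x) \<le> C * nrm1 x"
proof -
  interpret N1: complete_norm s1 nrm1 by fact
  interpret N2: complete_norm s2 nrm2 by fact
  interpret T: Vector_Spaces.linear s1 s2 T by fact
  have "(\<Union>n. {x. nrm2 (T x) \<le> real n}) = UNIV"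
    using real_arch_simple by auto
  then obtain n a r where r: "0 < r" and dense:
      "\<forall>x. nrm1 (x - a) < r \<longrightarrow> (\<forall>e>0. \<exists>y\<in>{x. nrm2 (T x) \<le> real n}. nrm1 (x - y) < e)"
    by (rule N1.baire_cover)
  \<comment> \<open>Two vectors of the sublevel set contribute \<open>2 * real n\<close>; rescaling
    by \<open>1 / c = 2 * nrm1 x / r\<close> supplies the rest.\<close>
  define K where "K = 4 * real n / r"
  have approx: "\<exists>y. nrm2 (T y) \<le> K * nrm1 x \<and> nrm1 (x - y) < e" if e: "0 < e" for x e
  proof (cases "x = 0")
    case True
    then show ?thesis using e by (intro exI[of _ 0]) (simp add: T.zero)
  next
    case False
    \<comment> \<open>Scales \<open>x\<close> to norm \<open>r / 2\<close>, so that
      \<open>a + c x\<close> stays inside the ball.\<close>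
    define c where "c = r / (2 * nrm1 x)"
    have nx: "0 < nrm1 x" using False N1.nrm_eq_0 N1.nrm_ge_0 by (metis less_eq_real_def)
    have c: "0 < c" using r nx by (simp add: c_def)
    have "nrm1 (a + s1 (of_real c) x - a) < r"
      using c nx r by (simp add: N1.nrm_scale, simp add: c_def)
    \<comment> \<open>The ball is not centred at 0, so \<open>a + c x\<close> and \<open>a\<close>
      are both approximated; the difference \<open>y1 - y0\<close> approximates \<open>c x\<close>.
      Each error is \<open>c * e / 2\<close>, since dividing by \<open>c\<close> must leave at most
      \<open>e\<close>.\<close>
    then obtain y1 where y1: "nrm2 (T y1) \<le> real n" "nrm1 (a + s1 (of_real c) x - y1) < c * e / 2"
      using dense c e by (metis (lifting) half_gt_zero mem_Collect_eq mult_pos_pos)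
    obtain y0 where y0: "nrm2 (T y0) \<le> real n" "nrm1 (a - y0) < c * e / 2"
      using dense c e r by (metis (lifting) N1.nrm_0 diff_self half_gt_zero mem_Collect_eq mult_pos_pos)
    define y where "y = s1 (of_real (1 / c)) (y1 - y0)"
    have "nrm2 (T y) = (1 / c) * nrm2 (T y1 - T y0)"
      using c by (simp add: y_def T.scale T.diff N2.nrm_scale norm_divide)
    also have "\<dots> \<le> (1 / c) * (2 * real n)"
      using c y1 y0 N2.nrm_diff_le[of "T y1" "T y0"] by (intro mult_left_mono) auto
    also have "\<dots> = K * nrm1 x"
      using r nx by (simp add: c_def K_def)
    finally have 1: "nrm2 (T y) \<le> K * nrm1 x" .
    have "s1 (of_real c) (x - y) = (a + s1 (of_real c) x - y1) - (a - y0)"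
      using c by (simp add: y_def N1.scale_right_diff_distrib)
    then have "c * nrm1 (x - y) = nrm1 ((a + s1 (of_real c) x - y1) - (a - y0))"
      using c N1.nrm_scale[of "of_real c" "x - y"] by simp
    also have "\<dots> < c * e"
      using y1(2) y0(2) N1.nrm_diff_le[of "a + s1 (of_real c) x - y1" "a - y0"] by simp
    finally have "nrm1 (x - y) < e" using c by simp
    with 1 show ?thesis by blast
  qed
  then have "\<forall>x e. \<exists>y. 0 < e \<longrightarrow> nrm2 (T y) \<le> K * nrm1 x \<and> nrm1 (x - y) < e"
    by blast
  then obtain Y where "\<forall>x e. 0 < e \<longrightarrow> nrm2 (T (Y x e)) \<le> K * nrm1 x \<and> nrm1 (x - Y x e) < e"
    unfolding choice_iff by blast
  then have Y: "nrm2 (T (Y x e)) \<le> K * nrm1 x" "nrm1 (x - Y x e) < e" if "0 < e" for x e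
    using that by blast+
  have "nrm2 (T x) \<le> 2 * K * nrm1 x" for x
  proof (cases "x = 0")
    case True
    then show ?thesis by (simp add: T.zero)
  next
    case False
    then have nx: "0 < nrm1 x" using N1.nrm_eq_0 N1.nrm_ge_0 by (metis less_eq_real_def)
    \<comment> \<open>Each step adds an approximant of the remaining error \<open>x - u\<close>. The
      tolerance halves every time, so the error before step \<open>k\<close> is at most
      \<open>nrm1 x / 2 ^ k\<close>, which also holds at \<open>k = 0\<close>.\<close>
    define s where "s = rec_nat 0 (\<lambda>k u. u + Y (x - u) (nrm1 x / 2 ^ Suc k))"
    have s0: "s 0 = 0" and sS: "s (Suc k) = s k + Y (x - s k) (nrm1 x / 2 ^ Suc k)" for k
      by (simp_all add: s_def)
    have near: "nrm1 (x - s k) \<le> nrm1 x / 2 ^ k" for k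
    proof (cases k)
      case (Suc j)
      then show ?thesis
        using Y(2)[of "nrm1 x / 2 ^ Suc j" "x - s j"] nx by (simp add: sS diff_diff_eq)
    qed (simp add: s0)
    have "nrm2 (T (s (Suc k)) - T (s k)) \<le> (K * nrm1 x) / 2 ^ k" for k
    proof -
      have "nrm2 (T (s (Suc k)) - T (s k)) \<le> K * nrm1 (x - s k)"
        using Y(1)[of "nrm1 x / 2 ^ Suc k" "x - s k"] nx by (simp add: sS T.add)
      also have "\<dots> \<le> K * (nrm1 x / 2 ^ k)"
        using r near by (intro mult_left_mono) (auto simp: K_def)
      finally show ?thesis by simp
    qed
    then obtain z where z: "(\<lambda>k. nrm2 (T (s k) - z)) \<longlonglongrightarrow> 0" "nrm2 (z - T (s 0)) \<le> 2 * (K * nrm1 x)"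
      by (rule N2.geometric_convergent)
    have bound: "nrm1 (s k - x) \<le> nrm1 x * (1 / 2) ^ k" for k
      using near[of k] N1.nrm_commute[of x "s k"] by (simp add: power_one_over)
    have "(\<lambda>k. nrm1 x * (1 / 2) ^ k) \<longlonglongrightarrow> nrm1 x * 0"
      by (intro tendsto_mult tendsto_const LIMSEQ_power_zero) simp
    then have "(\<lambda>k. nrm1 x * (1 / 2) ^ k) \<longlonglongrightarrow> 0" by simp
    then have "(\<lambda>k. nrm1 (s k - x)) \<longlonglongrightarrow> 0"
      by (rule Lim_null_comparison[rotated]) (simp add: bound)
    then have "T x = z" using z(1) by (rule closed)
    then show ?thesis using z(2) by (simp add: s0 T.zero)
  qed
  then show ?thesis by blast
qed

section \<open>Positive definite subspaces and Riesz representation\<close>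

context hermitian_space
begin

lemma form_add_left: "form (x + y) z = form x z + form y z"
  and form_scale_left: "form (cscale c x) y = c * form x y"
  and form_commute: "form y x = cnj (form x y)"
  using hermitian unfolding hermitian_form_on_def by blast+

lemma form_add_right: "form x (y + z) = form x y + form x z"
  by (subst (1 2 3) form_commute) (simp add: form_add_left)

lemma form_scale_right: "form x (cscale c y) = cnj c * form x y"
  by (subst (1 2) form_commute) (simp add: form_scale_left)

lemma form_0_left [simp]: "form 0 y = 0"
  using form_scale_left[of 0 0 y] by simp

lemma form_0_right [simp]: "form x 0 = 0"
  using form_scale_right[of x 0 0] by simp

lemma form_minus_left: "form (- x) y = - form x y"
  using form_scale_left[of "- 1" x y] by simp

lemma form_minus_right: "form x (- y) = - form x y"
  using form_scale_right[of x "- 1" y] by simp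

lemma form_diff_left: "form (x - y) z = form x z - form y z"
  using form_add_left[of x "- y" z] by (simp add: form_minus_left)

lemma form_diff_right: "form x (y - z) = form x y - form x z"
  using form_add_right[of x y "- z"] by (simp add: form_minus_right)

lemmas form_simps = form_add_left form_add_right form_diff_left form_diff_right
  form_minus_left form_minus_right form_scale_left form_scale_right

lemma Im_form_self [simp]: "Im (form x x) = 0"
  using form_commute[of x x] by (simp add: complex_eq_iff)

lemma form_norm_scale: "form_norm form (cscale c x) = cmod c * form_norm form x"
  by (simp add: form_norm_def form_simps norm_mult real_sqrt_mult)

lemma form_norm_minus: "form_norm form (- x) = form_norm form x"
  by (simp add: form_norm_def form_simps)

lemma form_norm_0 [simp]: "form_norm form 0 = 0"
  by (simp add: form_norm_def)

end

locale positive_subspace = hermitian_space +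
  fixes S
  assumes subspace_S: "subspace S"
    and positive: "x \<in> S \<Longrightarrow> form x x \<in> \<real>\<^sub>\<ge>\<^sub>0"
    and definite: "x \<in> S \<Longrightarrow> form x x = 0 \<Longrightarrow> x = 0"
begin

lemmas S_closed [simp] = subspace_0[OF subspace_S] subspace_add[OF subspace_S]
  subspace_diff[OF subspace_S] subspace_neg[OF subspace_S] subspace_scale[OF subspace_S]

lemma form_norm_eq: "x \<in> S \<Longrightarrow> form_norm form x = sqrt (Re (form x x))"
  using positive[of x] by (simp add: form_norm_def cmod_eq_Re complex_nonneg_Reals_iff)

lemma form_norm_square: "x \<in> S \<Longrightarrow> (form_norm form x)\<^sup>2 = Re (form x x)"
  using positive[of x] by (simp add: form_norm_eq complex_nonneg_Reals_iff)

lemma form_self: "x \<in> S \<Longrightarrow> form x x = of_real ((form_norm form x)\<^sup>2)"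
  by (simp add: form_norm_square complex_eq_iff)

lemma form_norm_nonneg [simp]: "0 \<le> form_norm form x"
  by (simp add: form_norm_def)

lemma form_norm_eq_0: "x \<in> S \<Longrightarrow> form_norm form x = 0 \<Longrightarrow> x = 0"
  using form_self[of x] definite[of x] by simp

text \<open>
  If \<open>x\<close> minimizes \<open>\<phi> z = form z z - 2 Re (f z)\<close> up to \<open>\<delta>\<close>, then testing with
  \<open>z = x + t y\<close>, \<open>t\<close> a suitable multiple of \<open>f y - form y x\<close>, bounds \<open>f y - form y x\<close>.
  With \<open>f = 0\<close>, \<open>\<delta> = form x x\<close> this is the Cauchy-Schwarz inequality.
\<close>

lemma almost_minimizer:
  assumes x: "x \<in> S" and y: "y \<in> S"
    and f: "\<And>a b. a \<in> S \<Longrightarrow> b \<in> S \<Longrightarrow> f (a + b) = f a + f b"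
      "\<And>c a. a \<in> S \<Longrightarrow> f (cscale c a) = c * f a"
    and min: "\<And>z. z \<in> S \<Longrightarrow> Re (form x x) - 2 * Re (f x) \<le> Re (form z z) - 2 * Re (f z) + \<delta>"
  shows "(cmod (f y - form y x))\<^sup>2 \<le> \<delta> * (form_norm form y)\<^sup>2"
proof (cases "y = 0")
  case True
  then show ?thesis using f(2)[of 0 0] by simp
next
  case False
  define w where "w = f y - form y x"
  define q where "q = (form_norm form y)\<^sup>2"
  have q: "0 < q" using False form_norm_eq_0[OF y] by (auto simp: q_def)
  define t where "t = cnj w / of_real q"
  have xy: "form x y = cnj (form y x)" by (rule form_commute)
  have "form (x + cscale t y) (x + cscale t y)
      = form x x + t * form y x + cnj (t * form y x) + t * cnj t * of_real q"
    using form_self[OF y] by (simp add: form_simps xy q_def algebra_simps)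
  then have "Re (form (x + cscale t y) (x + cscale t y))
      = Re (form x x) + 2 * Re (t * form y x) + (cmod t)\<^sup>2 * q"
    by (simp add: complex_norm_square[symmetric])
  moreover have "f (x + cscale t y) = f x + t * f y" using x y f by simp
  ultimately have "0 \<le> (cmod t)\<^sup>2 * q - 2 * Re (t * w) + \<delta>"
    using min[of "x + cscale t y"] x y by (simp add: w_def algebra_simps)
  moreover have "(cmod t)\<^sup>2 * q = (cmod w)\<^sup>2 / q"
    using q by (simp add: t_def norm_divide power_divide power2_eq_square)
  moreover have "t * w = of_real ((cmod w)\<^sup>2 / q)"
    unfolding t_def of_real_divide complex_norm_square by simp
  ultimately have "(cmod w)\<^sup>2 / q \<le> \<delta>" by simp
  then show ?thesis using q by (simp add: w_def q_def field_simps)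
qed

lemma cauchy_schwarz:
  assumes "x \<in> S" "y \<in> S"
  shows "cmod (form x y) \<le> form_norm form x * form_norm form y"
proof -
  have "(cmod (0 - form y x))\<^sup>2 \<le> (form_norm form x)\<^sup>2 * (form_norm form y)\<^sup>2"
    by (rule almost_minimizer[where f = "\<lambda>_. 0"])
      (use assms in \<open>auto simp: form_norm_square positive[unfolded complex_nonneg_Reals_iff]\<close>)
  then have "(cmod (form x y))\<^sup>2 \<le> (form_norm form x * form_norm form y)\<^sup>2"
    by (subst form_commute) (simp add: power_mult_distrib)
  then show ?thesis by (rule power2_le_imp_le) simp
qed

lemma form_norm_triangle:
  assumes "x \<in> S" "y \<in> S"
  shows "form_norm form (x + y) \<le> form_norm form x + form_norm form y"
proof (rule power2_le_imp_le)
  have "Re (form y x) = Re (form x y)" by (subst form_commute) simp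
  then have "(form_norm form (x + y))\<^sup>2 = (form_norm form x)\<^sup>2 + (form_norm form y)\<^sup>2 + 2 * Re (form x y)"
    using assms by (simp add: form_norm_square form_simps)
  also have "\<dots> \<le> (form_norm form x + form_norm form y)\<^sup>2"
    using complex_Re_le_cmod[of "form x y"] cauchy_schwarz[OF assms] by (simp add: power2_sum)
  finally show "(form_norm form (x + y))\<^sup>2 \<le> (form_norm form x + form_norm form y)\<^sup>2" .
qed simp

lemma Metric_space_form_dist: "Metric_space S (form_dist form)"
proof
  show "0 \<le> form_dist form x y" for x y by (simp add: form_dist_def)
  show "form_dist form x y = form_dist form y x" for x y
    using form_norm_minus[of "x - y"] by (simp add: form_dist_def)
  show "form_dist form x y = 0 \<longleftrightarrow> x = y" if "x \<in> S" "y \<in> S" for x y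
    using that form_norm_eq_0[of "x - y"] by (auto simp: form_dist_def form_norm_def)
  show "form_dist form x z \<le> form_dist form x y + form_dist form y z"
    if "x \<in> S" "y \<in> S" "z \<in> S" for x y z
    using that form_norm_triangle[of "x - y" "y - z"] by (simp add: form_dist_def)
qed

text \<open>Written with the midpoint because that is the competitor in \<open>S\<close> against
  which a minimizing sequence is compared.\<close>

lemma parallelogram:
  assumes "x \<in> S" "y \<in> S"
  shows "(form_norm form (x - y))\<^sup>2
    = 2 * Re (form x x) + 2 * Re (form y y) - 4 * Re (form (cscale (1/2) (x + y)) (cscale (1/2) (x + y)))"
  using assms by (simp add: form_norm_square form_simps algebra_simps)

end

text \<open>Completeness refers to sequences in \<open>S\<close> and the norm of the form itself, so
  it can be verified alike for the summands of a fundamental decomposition, for their direct sum and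
  for closed uniformly positive subspaces.\<close>

locale hilbert_subspace = positive_subspace +
  assumes complete: "\<And>s. \<lbrakk>\<And>n. s n \<in> S; \<And>e. 0 < e \<Longrightarrow> \<exists>K. \<forall>m\<ge>K. \<forall>n\<ge>K. form_norm form (s m - s n) < e\<rbrakk>
      \<Longrightarrow> \<exists>x\<in>S. (\<lambda>n. form_norm form (s n - x)) \<longlonglongrightarrow> 0"
begin

text \<open>The representing vector is the minimizer of \<open>\<phi>\<close>. A minimizing sequence
  is Cauchy by the parallelogram law, and the estimate for almost minimizers gives the
  representation up to an error that vanishes in the limit, without passing to the limit in
  \<open>\<phi>\<close>.\<close>

theorem riesz_representation:
  assumes f: "\<And>a b. a \<in> S \<Longrightarrow> b \<in> S \<Longrightarrow> f (a + b) = f a + f b"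
      "\<And>c a. a \<in> S \<Longrightarrow> f (cscale c a) = c * f a"
    and bounded: "\<And>x. x \<in> S \<Longrightarrow> cmod (f x) \<le> C * form_norm form x"
  shows "\<exists>u\<in>S. \<forall>y\<in>S. f y = form y u"
proof -
  define \<phi> where "\<phi> x = Re (form x x) - 2 * Re (f x)" for x
  define m where "m = Inf (\<phi> ` S)"
  \<comment> \<open>Completing the square: the squared norm minus \<open>2 C\<close> times the norm
    is at least minus the square of \<open>C\<close>.\<close>
  have "- (C\<^sup>2) \<le> \<phi> x" if "x \<in> S" for x
  proof -
    have "Re (f x) \<le> C * form_norm form x"
      using bounded[OF that] complex_Re_le_cmod[of "f x"] by linarith
    moreover have "0 \<le> (form_norm form x - C)\<^sup>2" by simp
    ultimately show ?thesis
      using that by (simp add: \<phi>_def form_norm_square[symmetric] power2_diff mult.commute mult.left_commute)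
  qed
  then have bdd: "bdd_below (\<phi> ` S)" by fast
  have m: "m \<le> \<phi> x" if "x \<in> S" for x
    unfolding m_def using bdd that by (intro cInf_lower) auto
  have "S \<noteq> {}" using S_closed(1) by blast
  then have "\<exists>x\<in>S. \<phi> x < m + \<delta>" if "0 < \<delta>" for \<delta>
    using cInf_lessD[of "\<phi> ` S" "m + \<delta>"] that by (auto simp: m_def)
  then have "\<forall>n. \<exists>x. x \<in> S \<and> \<phi> x < m + inverse (real (Suc n))"
    by (metis inverse_positive_iff_positive of_nat_0_less_iff zero_less_Suc)
  then obtain s where "\<forall>n. s n \<in> S \<and> \<phi> (s n) < m + inverse (real (Suc n))"
    unfolding choice_iff by blast
  then have s: "s n \<in> S" "\<phi> (s n) < m + inverse (real (Suc n))" for n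
    by blast+
  \<comment> \<open>In \<open>2 \<phi> (s i) + 2 \<phi> (s j) - 4 \<phi> (midpoint)\<close> the
    terms with \<open>f\<close> cancel, since \<open>f\<close> is additive; what remains is the
    parallelogram law, and the midpoint value is at least \<open>m\<close>.\<close>
  have close: "(form_norm form (s i - s j))\<^sup>2 \<le> 4 * inverse (real (Suc k))" if "k \<le> i" "k \<le> j" for i j k
  proof -
    have inv: "inverse (real (Suc n)) \<le> inverse (real (Suc k))" if "k \<le> n" for n
      using that by (intro le_imp_inverse_le) auto
    have "2 * Re (f (cscale (1/2) (s i + s j))) = Re (f (s i)) + Re (f (s j))"
      using s(1) f by simp
    then have "(form_norm form (s i - s j))\<^sup>2 = 2 * \<phi> (s i) + 2 * \<phi> (s j) - 4 * \<phi> (cscale (1/2) (s i + s j))"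
      using parallelogram[OF s(1) s(1), of i j] by (simp add: \<phi>_def)
    also have "\<dots> \<le> 2 * inverse (real (Suc i)) + 2 * inverse (real (Suc j))"
      using s(2)[of i] s(2)[of j] m[of "cscale (1/2) (s i + s j)"] s(1) by simp
    also have "\<dots> \<le> 4 * inverse (real (Suc k))"
      using inv[OF that(1)] inv[OF that(2)] by linarith
    finally show ?thesis .
  qed
  have cauchy: "\<exists>K. \<forall>i\<ge>K. \<forall>j\<ge>K. form_norm form (s i - s j) < e" if "0 < e" for e
  proof -
    obtain K where "inverse (real (Suc K)) < e\<^sup>2 / 4"
      using reals_Archimedean[of "e\<^sup>2 / 4"] \<open>0 < e\<close> by auto
    then have "(form_norm form (s i - s j))\<^sup>2 < e\<^sup>2" if "K \<le> i" "K \<le> j" for i j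
      using close[OF that] by simp
    then show ?thesis using that by (meson less_imp_le power_less_imp_less_base)
  qed
  obtain u where u: "u \<in> S" "(\<lambda>n. form_norm form (s n - u)) \<longlonglongrightarrow> 0"
    using complete[OF s(1) cauchy] by blast
  have "f y = form y u" if y: "y \<in> S" for y
  proof -
    have "cmod (f y - form y u) \<le> (sqrt (inverse (real (Suc n))) + form_norm form (s n - u)) * form_norm form y" for n
    proof -
      have "(cmod (f y - form y (s n)))\<^sup>2 \<le> inverse (real (Suc n)) * (form_norm form y)\<^sup>2"
      proof (rule almost_minimizer[OF s(1) y f])
        show "Re (form (s n) (s n)) - 2 * Re (f (s n)) \<le> Re (form z z) - 2 * Re (f z) + inverse (real (Suc n))"
          if "z \<in> S" for z
          using s(2)[of n] m[OF that] by (simp add: \<phi>_def)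
      qed
      then have "cmod (f y - form y (s n)) \<le> sqrt (inverse (real (Suc n))) * form_norm form y"
        by (metis form_norm_nonneg norm_ge_zero real_sqrt_le_iff real_sqrt_mult real_sqrt_unique)
      moreover have "cmod (form y (s n - u)) \<le> form_norm form y * form_norm form (s n - u)"
        using s(1) u(1) y by (intro cauchy_schwarz) auto
      moreover have "f y - form y u = (f y - form y (s n)) + form y (s n - u)"
        by (simp add: form_simps)
      ultimately show ?thesis
        using norm_triangle_ineq[of "f y - form y (s n)" "form y (s n - u)"] by (simp add: algebra_simps)
    qed
    moreover have "(\<lambda>n. (sqrt (inverse (real (Suc n))) + form_norm form (s n - u)) * form_norm form y)
        \<longlonglongrightarrow> (sqrt 0 + 0) * form_norm form y"
      by (intro tendsto_intros LIMSEQ_inverse_real_of_nat u(2))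
    ultimately have "cmod (f y - form y u) \<le> (sqrt 0 + 0) * form_norm form y"
      by (intro LIMSEQ_le_const) auto
    then show ?thesis by simp
  qed
  with u(1) show ?thesis by blast
qed

end

section \<open>Norms of fundamental decompositions\<close>

context hermitian_space
begin

text \<open>Lets the results on positive subspaces be applied to the negative summand
  \<open>M\<close>.\<close>

lemma hermitian_space_uminus: "hermitian_space cscale (\<lambda>x y. - form x y)"
proof
  show "hermitian_form_on cscale UNIV (\<lambda>x y. - form x y)"
    unfolding hermitian_form_on_def
  proof (intro conjI ballI allI)
    show "- form y x = cnj (- form x y)" for x y
      by (simp add: form_commute[of x y])
  qed (simp_all add: form_simps)
qed

lemma separable_hilbert_on_imp_hilbert_subspace:
  assumes "separable_hilbert_on cscale S form"
  shows "hilbert_subspace cscale form S"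
proof -
  interpret positive_subspace cscale form S
    using assms unfolding separable_hilbert_on_def by unfold_locales blast+
  interpret D: Metric_space S "form_dist form"
    by (rule Metric_space_form_dist)
  show ?thesis
  proof
    fix s :: "nat \<Rightarrow> 'a"
    assume S: "\<And>n. s n \<in> S"
      and "\<And>e. 0 < e \<Longrightarrow> \<exists>K. \<forall>m\<ge>K. \<forall>n\<ge>K. form_norm form (s m - s n) < e"
    then have "D.MCauchy s"
      unfolding D.MCauchy_def form_dist_def by blast
    then obtain x where "limitin D.mtopology s x sequentially"
      using assms unfolding separable_hilbert_on_def D.mcomplete_def by blast
    then show "\<exists>x\<in>S. (\<lambda>n. form_norm form (s n - x)) \<longlonglongrightarrow> 0"
      using S by (auto simp: D.limit_metric_sequentially form_dist_def LIMSEQ_iff)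
  qed
qed

end

lemma hilbert_UNIV_imp_complete_norm:
  assumes "hilbert_subspace cscale g UNIV"
  shows "complete_norm cscale (form_norm g)"
proof -
  interpret hilbert_subspace cscale g UNIV by fact
  interpret complex_norm cscale "form_norm g"
  proof
    show "form_norm g x = 0 \<Longrightarrow> x = 0" for x by (rule form_norm_eq_0[OF UNIV_I])
    show "form_norm g (x + y) \<le> form_norm g x + form_norm g y" for x y
      by (rule form_norm_triangle) (rule UNIV_I)+
    show "form_norm g (cscale c x) = cmod c * form_norm g x" for c x
      by (rule form_norm_scale)
  qed
  show ?thesis
  proof
    show mcomplete
      unfolding mcomplete_def MCauchy_def limitin_iff
    proof (intro allI impI)
      fix s :: "nat \<Rightarrow> 'a"
      assume "range s \<subseteq> UNIV \<and> (\<forall>e>0. \<exists>K. \<forall>m n. K \<le> m \<longrightarrow> K \<le> n \<longrightarrow> form_norm g (s m - s n) < e)"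
      then have cauchy: "\<exists>K. \<forall>m\<ge>K. \<forall>n\<ge>K. form_norm g (s m - s n) < e" if "0 < e" for e
        using that by simp
      obtain x where "(\<lambda>n. form_norm g (s n - x)) \<longlonglongrightarrow> 0"
        using complete[OF UNIV_I cauchy] by (rule bexE)
      then show "\<exists>x. (\<lambda>n. form_norm g (s n - x)) \<longlonglongrightarrow> 0" ..
    qed
  qed
qed

section \<open>The Hilbert space and the symmetry belonging to a fundamental decomposition\<close>

locale fundamental = hermitian_space +
  fixes P M
  assumes fd: "fundamental_decomposition P M"
begin

sublocale P: hilbert_subspace cscale form P
  using fd by (intro separable_hilbert_on_imp_hilbert_subspace) (simp add: fundamental_decomposition_def)

sublocale M: hilbert_subspace cscale "\<lambda>x y. - form x y" M
  using fd by (intro hermitian_space.separable_hilbert_on_imp_hilbert_subspace hermitian_space_uminus)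
    (simp add: fundamental_decomposition_def)

abbreviation pos where "pos \<equiv> component P M"
abbreviation neg where "neg \<equiv> component M P"
abbreviation inner where "inner \<equiv> fd_inner P M"
abbreviation nrm where "nrm \<equiv> fd_norm P M"

lemma components_unique:
  assumes "u \<in> P" "v \<in> M" "x = u + v"
  shows "pos x = u" "neg x = v"
proof -
  have eq: "u' = u" "v' = v" if "u' \<in> P" "v' \<in> M" "u' + v' = x" for u' v'
  proof -
    have "u' - u = v - v'" using that assms by (simp add: algebra_simps)
    moreover have "u' - u \<in> P" "v - v' \<in> M" using that assms by auto
    moreover have "P \<inter> M = {0}" using fd by (simp add: fundamental_decomposition_def)
    ultimately have "u' - u = 0" by (metis IntI singletonD)
    with \<open>u' - u = v - v'\<close> show "u' = u" "v' = v" by auto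
  qed
  show "pos x = u" unfolding component_def
  proof (rule the_equality)
    show "u \<in> P \<and> x - u \<in> M" using assms by simp
    show "w = u" if "w \<in> P \<and> x - w \<in> M" for w
      using that eq(1)[of w "x - w"] by simp
  qed
  show "neg x = v" unfolding component_def
  proof (rule the_equality)
    show "v \<in> M \<and> x - v \<in> P" using assms by simp
    show "w = v" if "w \<in> M \<and> x - w \<in> P" for w
      using that eq(2)[of "x - w" w] by simp
  qed
qed

lemma components [simp]: "pos x \<in> P" "neg x \<in> M" "pos x + neg x = x"
proof -
  obtain u v where "u \<in> P" "v \<in> M" "x = u + v"
    using fd unfolding fundamental_decomposition_def by blast
  then show "pos x \<in> P" "neg x \<in> M" "pos x + neg x = x"
    using components_unique[of u v x] by auto
qed

lemma pos_add: "pos (x + y) = pos x + pos y" and neg_add: "neg (x + y) = neg x + neg y"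
proof -
  have "x + y = (pos x + pos y) + (neg x + neg y)"
    using arg_cong2[OF components(3)[of x] components(3)[of y], of "(+)"] by (simp only: ac_simps)
  from components_unique[OF _ _ this] show "pos (x + y) = pos x + pos y" "neg (x + y) = neg x + neg y"
    by simp_all
qed

lemma pos_scale: "pos (cscale c x) = cscale c (pos x)" and neg_scale: "neg (cscale c x) = cscale c (neg x)"
proof -
  have "cscale c x = cscale c (pos x) + cscale c (neg x)"
    by (simp add: scale_right_distrib[symmetric])
  from components_unique[OF _ _ this] show "pos (cscale c x) = cscale c (pos x)" "neg (cscale c x) = cscale c (neg x)"
    by simp_all
qed

lemma pos_diff: "pos (x - y) = pos x - pos y" and neg_diff: "neg (x - y) = neg x - neg y"
  using pos_add[of "x - y" y] neg_add[of "x - y" y] by (simp_all add: eq_diff_eq)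

lemma form_orthogonal: "u \<in> P \<Longrightarrow> v \<in> M \<Longrightarrow> form u v = 0" "u \<in> P \<Longrightarrow> v \<in> M \<Longrightarrow> form v u = 0"
proof -
  show "form u v = 0" if "u \<in> P" "v \<in> M" for u v
    using fd that by (simp add: fundamental_decomposition_def)
  then show "form v u = 0" if "u \<in> P" "v \<in> M" for u v
    using that by (subst form_commute) simp
qed

lemma form_components: "form x y = form (pos x) (pos y) + form (neg x) (neg y)"
proof -
  have "form x y = form (pos x + neg x) (pos y + neg y)" by simp
  also have "\<dots> = form (pos x) (pos y) + form (neg x) (neg y)"
    by (simp add: form_simps form_orthogonal del: components(3))
  finally show ?thesis .
qed

text \<open>The fundamental symmetry of the decomposition: an isometric involution that exchanges
  the indefinite form and the Hilbert inner product.\<close>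

definition J where "J x = pos x - neg x"

lemma components_J: "pos (J x) = pos x" "neg (J x) = - neg x"
  by (rule components_unique[of _ "- neg x"]; simp add: J_def)+

lemma form_J: "form (J x) y = inner x y" "form x (J y) = inner x y"
  by (simp_all add: form_components[of "J x"] form_components[of x] components_J fd_inner_def form_simps)

lemma inner_J: "inner (J x) y = form x y" "inner (J x) (J y) = inner x y"
  by (simp_all add: form_components[of x] components_J fd_inner_def form_simps)

lemma nrm_J: "nrm (J x) = nrm x"
  by (simp add: fd_norm_def form_norm_def inner_J form_J)

lemma inner_self: "inner x x = form (pos x) (pos x) - form (neg x) (neg x)"
  by (simp add: fd_inner_def)

lemma nrm_square: "(nrm x)\<^sup>2 = (form_norm form (pos x))\<^sup>2 + (form_norm (\<lambda>x y. - form x y) (neg x))\<^sup>2"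
proof -
  have 1: "0 \<le> Re (form (pos x) (pos x))" "0 \<le> Re (- form (neg x) (neg x))"
    using P.positive[of "pos x"] M.positive[of "neg x"] by (simp_all add: complex_nonneg_Reals_iff)
  then have "(nrm x)\<^sup>2 = Re (inner x x)"
    by (simp add: fd_norm_def form_norm_def cmod_eq_Re inner_self)
  then show ?thesis
    by (simp add: inner_self P.form_norm_square M.form_norm_square)
qed

text \<open>Makes Cauchy-Schwarz and Riesz available on the whole space. Completeness is checked on
  the two components separately.\<close>

sublocale H: hilbert_subspace cscale inner UNIV
proof
  show "hermitian_form_on cscale UNIV inner"
    unfolding hermitian_form_on_def
  proof (intro conjI ballI allI)
    show "inner (x + y) z = inner x z + inner y z" for x y z
      by (simp add: fd_inner_def pos_add neg_add form_simps)
    show "inner (cscale c x) y = c * inner x y" for c x y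
      by (simp add: fd_inner_def pos_scale neg_scale form_simps algebra_simps)
    show "inner y x = cnj (inner x y)" for x y
      by (simp add: fd_inner_def form_commute[of "pos x" "pos y"] form_commute[of "neg x" "neg y"])
  qed
  show "subspace UNIV" by (rule subspace_UNIV)
  show "inner x x \<in> \<real>\<^sub>\<ge>\<^sub>0" for x
    using P.positive[of "pos x"] M.positive[of "neg x"]
    by (simp add: inner_self complex_nonneg_Reals_iff)
  show "x = 0" if "inner x x = 0" for x
  proof -
    have zero: "nrm x = 0" using that by (simp add: fd_norm_def form_norm_def)
    have "form_norm form (pos x) = 0" "form_norm (\<lambda>x y. - form x y) (neg x) = 0"
      using nrm_square[of x] zero by simp_all
    then have "pos x = 0" "neg x = 0"
      using P.form_norm_eq_0[OF components(1)] M.form_norm_eq_0[OF components(2)] by blast+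
    then show ?thesis using components(3)[of x] by simp
  qed
  fix s :: "nat \<Rightarrow> 'a"
  assume cauchy: "\<And>e. 0 < e \<Longrightarrow> \<exists>K. \<forall>m\<ge>K. \<forall>n\<ge>K. form_norm inner (s m - s n) < e"
  have nonneg: "0 \<le> form_norm inner x" for x by (simp add: form_norm_def)
  have le: "form_norm form (pos x) \<le> form_norm inner x" for x
    using nrm_square[of x] by (intro power2_le_imp_le[OF _ nonneg]) (simp add: fd_norm_def)
  have le': "form_norm (\<lambda>x y. - form x y) (neg x) \<le> form_norm inner x" for x
    using nrm_square[of x] by (intro power2_le_imp_le[OF _ nonneg]) (simp add: fd_norm_def)
  have P_cauchy: "\<exists>K. \<forall>m\<ge>K. \<forall>n\<ge>K. form_norm form (pos (s m) - pos (s n)) < e" if "0 < e" for e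
  proof -
    obtain K where "\<forall>m\<ge>K. \<forall>n\<ge>K. form_norm inner (s m - s n) < e"
      using cauchy[OF \<open>0 < e\<close>] ..
    then have "\<forall>m\<ge>K. \<forall>n\<ge>K. form_norm form (pos (s m) - pos (s n)) < e"
      using le_less_trans[OF le[of "s _ - s _"]] by (simp add: pos_diff)
    then show ?thesis ..
  qed
  have M_cauchy: "\<exists>K. \<forall>m\<ge>K. \<forall>n\<ge>K. form_norm (\<lambda>x y. - form x y) (neg (s m) - neg (s n)) < e"
    if "0 < e" for e
  proof -
    obtain K where "\<forall>m\<ge>K. \<forall>n\<ge>K. form_norm inner (s m - s n) < e"
      using cauchy[OF \<open>0 < e\<close>] ..
    then have "\<forall>m\<ge>K. \<forall>n\<ge>K. form_norm (\<lambda>x y. - form x y) (neg (s m) - neg (s n)) < e"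
      using le_less_trans[OF le'[of "s _ - s _"]] by (simp add: neg_diff)
    then show ?thesis ..
  qed
  obtain u where u: "u \<in> P" "(\<lambda>n. form_norm form (pos (s n) - u)) \<longlonglongrightarrow> 0"
    using P.complete[OF _ P_cauchy] by auto
  obtain v where v: "v \<in> M" "(\<lambda>n. form_norm (\<lambda>x y. - form x y) (neg (s n) - v)) \<longlonglongrightarrow> 0"
    using M.complete[OF _ M_cauchy] by auto
  \<comment> \<open>The direct sum norm is the Euclidean combination of the component norms, so
    limits of the components give a limit of the sum.\<close>
  have "form_norm inner x = sqrt ((form_norm form (pos x))\<^sup>2 + (form_norm (\<lambda>x y. - form x y) (neg x))\<^sup>2)" for x
    unfolding nrm_square[symmetric] by (simp add: fd_norm_def form_norm_def)
  then have "form_norm inner (s n - (u + v))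
      = sqrt ((form_norm form (pos (s n) - u))\<^sup>2 + (form_norm (\<lambda>x y. - form x y) (neg (s n) - v))\<^sup>2)" for n
    using u(1) v(1) components_unique[of u v "u + v"] by (simp add: pos_diff neg_diff)
  moreover have "(\<lambda>n. sqrt ((form_norm form (pos (s n) - u))\<^sup>2 + (form_norm (\<lambda>x y. - form x y) (neg (s n) - v))\<^sup>2))
      \<longlonglongrightarrow> sqrt (0\<^sup>2 + 0\<^sup>2)"
    by (intro tendsto_intros u v)
  ultimately have "(\<lambda>n. form_norm inner (s n - (u + v))) \<longlonglongrightarrow> sqrt (0\<^sup>2 + 0\<^sup>2)"
    by (simp only:)
  then have "(\<lambda>n. form_norm inner (s n - (u + v))) \<longlonglongrightarrow> 0"
    by (simp only: power_zero_numeral add_0 real_sqrt_zero)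
  then show "\<exists>x\<in>UNIV. (\<lambda>n. form_norm inner (s n - x)) \<longlonglongrightarrow> 0"
    by (rule bexI) (rule UNIV_I)
qed

sublocale N: complete_norm cscale nrm
  unfolding fd_norm_def by (rule hilbert_UNIV_imp_complete_norm) (rule H.hilbert_subspace_axioms)

text \<open>\<open>J\<close> turns the form into the inner product and preserves the norm, so
  Cauchy-Schwarz for the inner product becomes continuity of the form.\<close>

lemma form_le: "cmod (form x y) \<le> nrm x * nrm y"
  using H.cauchy_schwarz[of "J x" y] nrm_J[of x] by (simp add: inner_J fd_norm_def)

lemma nrm_square_eq: "(nrm x)\<^sup>2 = Re (inner x x)"
  by (simp add: fd_norm_def H.form_norm_square)

lemma nondegenerate:
  assumes "\<And>z. form x z = 0"
  shows "x = 0"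
proof -
  have "inner x x = 0" using assms[of "J x"] by (simp add: form_J)
  then show ?thesis by (rule H.definite[rotated]) simp
qed

lemma form_right_eqI:
  assumes "\<And>z. form z x = form z y"
  shows "x = y"
proof -
  have "form (x - y) z = 0" for z
    by (subst form_commute) (simp add: form_simps assms)
  then show ?thesis using nondegenerate by fastforce
qed

end

section \<open>Equivalence of the norms of all fundamental decompositions\<close>

context hermitian_space
begin

theorem fd_norms_equivalent:
  assumes fd: "fundamental_decomposition P M" and fd': "fundamental_decomposition P' M'"
  shows "\<exists>C>0. \<forall>x. fd_norm P' M' x \<le> C * fd_norm P M x"
proof -
  interpret F: fundamental cscale form P M by unfold_locales (rule fd)
  interpret F': fundamental cscale form P' M' by unfold_locales (rule fd')
  have "\<exists>C. \<forall>x. F'.nrm x \<le> C * F.nrm x"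
  proof (rule closed_graph[where T = "\<lambda>x. x"])
    show "complete_norm cscale F.nrm" "complete_norm cscale F'.nrm"
      by (rule F.N.complete_norm_axioms F'.N.complete_norm_axioms)+
    show "Vector_Spaces.linear cscale cscale (\<lambda>x. x)" by (rule linear_ident)
    fix s x y
    assume lim: "(\<lambda>n. F.nrm (s n - x)) \<longlonglongrightarrow> 0" "(\<lambda>n. F'.nrm (s n - y)) \<longlonglongrightarrow> 0"
    \<comment> \<open>A sequence with limit \<open>x\<close> in one norm and \<open>y\<close> in the
      other is seen by the form in both: splitting at \<open>s n\<close> leaves two terms, each
      controlled by its own norm.\<close>
    have "form (x - y) z = 0" for z
    proof -
      have "(\<lambda>n. F'.nrm (s n - y) * F'.nrm z + F.nrm (s n - x) * F.nrm z) \<longlonglongrightarrow> 0 * F'.nrm z + 0 * F.nrm z"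
        by (intro tendsto_intros lim)
      moreover have "cmod (form (x - y) z) \<le> F'.nrm (s n - y) * F'.nrm z + F.nrm (s n - x) * F.nrm z" for n
      proof -
        have "form (x - y) z = form (s n - y) z - form (s n - x) z" by (simp add: form_simps)
        then show ?thesis
          using norm_triangle_ineq4[of "form (s n - y) z" "form (s n - x) z"]
            F.form_le[of "s n - x" z] F'.form_le[of "s n - y" z] by simp
      qed
      ultimately have "cmod (form (x - y) z) \<le> 0 * F'.nrm z + 0 * F.nrm z"
        by (intro LIMSEQ_le_const) auto
      then show ?thesis by simp
    qed
    then show "x = y" using F.nondegenerate by fastforce
  qed
  then obtain C where C: "\<And>x. F'.nrm x \<le> C * F.nrm x" by blast
  \<comment> \<open>The closed graph theorem says nothing about the sign of
    \<open>C\<close>.\<close>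
  have "F'.nrm x \<le> (\<bar>C\<bar> + 1) * F.nrm x" for x
    by (rule order_trans[OF C mult_right_mono]) auto
  moreover have "0 < \<bar>C\<bar> + 1" by simp
  ultimately show ?thesis by blast
qed

end

section \<open>Bounded operators, adjoints and projections\<close>

context fundamental
begin

lemma equivalent:
  assumes "fundamental_decomposition P' M'"
  shows "\<exists>C>0. \<forall>x. fd_norm P' M' x \<le> C * nrm x \<and> nrm x \<le> C * fd_norm P' M' x"
proof -
  interpret F: fundamental cscale form P' M' by unfold_locales fact
  obtain A where A: "0 < A" "\<And>x. F.nrm x \<le> A * nrm x"
    using fd_norms_equivalent[OF fd assms] by blast
  obtain B where B: "0 < B" "\<And>x. nrm x \<le> B * F.nrm x"
    using fd_norms_equivalent[OF assms fd] by blast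
  have "F.nrm x \<le> max A B * nrm x" "nrm x \<le> max A B * F.nrm x" for x
    by (rule order_trans[OF A(2) mult_right_mono] order_trans[OF B(2) mult_right_mono]; simp)+
  moreover have "0 < max A B" using A(1) by simp
  ultimately show ?thesis by blast
qed

text \<open>Moves the bound from the witnessing decomposition to the fixed one; each of the two
  changes of norm costs a factor \<open>A\<close>. A nonnegative constant lets bounds be
  multiplied.\<close>

lemma bounded_ops_iff:
  "T \<in> bounded_ops \<longleftrightarrow> Vector_Spaces.linear cscale cscale T \<and> (\<exists>C\<ge>0. \<forall>x. nrm (T x) \<le> C * nrm x)"
proof (intro iffI conjI)
  assume "T \<in> bounded_ops"
  then obtain P' M' C where "Vector_Spaces.linear cscale cscale T" "fundamental_decomposition P' M'"
      and C: "\<And>x. fd_norm P' M' (T x) \<le> C * fd_norm P' M' x"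
    by (auto simp: bounded_ops_def)
  then show "Vector_Spaces.linear cscale cscale T" by blast
  interpret F: fundamental cscale form P' M' by unfold_locales fact
  obtain A where A: "0 < A" "\<And>x. F.nrm x \<le> A * nrm x" "\<And>x. nrm x \<le> A * F.nrm x"
    using equivalent[OF \<open>fundamental_decomposition P' M'\<close>] by blast
  have "nrm (T x) \<le> A * \<bar>C\<bar> * A * nrm x" for x
  proof -
    have "nrm (T x) \<le> A * F.nrm (T x)" by (rule A)
    also have "\<dots> \<le> A * (\<bar>C\<bar> * F.nrm x)"
      using A(1) by (intro mult_left_mono order_trans[OF C mult_right_mono]) auto
    also have "\<dots> \<le> A * (\<bar>C\<bar> * (A * nrm x))"
      using A(1) by (intro mult_left_mono A(2)) auto
    finally show ?thesis by (simp add: mult.assoc)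
  qed
  moreover have "0 \<le> A * \<bar>C\<bar> * A" using A(1) by simp
  ultimately show "\<exists>C\<ge>0. \<forall>x. nrm (T x) \<le> C * nrm x" by blast
next
  assume "Vector_Spaces.linear cscale cscale T \<and> (\<exists>C\<ge>0. \<forall>x. nrm (T x) \<le> C * nrm x)"
  then show "T \<in> bounded_ops" using fd unfolding bounded_ops_def by blast
qed

lemma bounded_opsI:
  assumes "Vector_Spaces.linear cscale cscale T" "\<And>x. nrm (T x) \<le> C * nrm x"
  shows "T \<in> bounded_ops"
  using assms fd unfolding bounded_ops_def by blast

lemma bounded_ops_linear: "T \<in> bounded_ops \<Longrightarrow> Vector_Spaces.linear cscale cscale T"
  by (simp add: bounded_ops_def)

lemma linearI:
  assumes "\<And>x y. T (x + y) = T x + T y" "\<And>c x. T (cscale c x) = cscale c (T x)"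
  shows "Vector_Spaces.linear cscale cscale T"
  by unfold_locales (use assms in auto)

lemma bounded_ops_comp:
  assumes "S \<in> bounded_ops" "T \<in> bounded_ops"
  shows "S \<circ> T \<in> bounded_ops"
proof -
  obtain A B where A: "0 \<le> A" "\<And>x. nrm (S x) \<le> A * nrm x" and B: "\<And>x. nrm (T x) \<le> B * nrm x"
    using assms unfolding bounded_ops_iff by blast
  show ?thesis
  proof (rule bounded_opsI)
    show "Vector_Spaces.linear cscale cscale (S \<circ> T)"
      by (rule Vector_Spaces.linear_compose) (rule assms[THEN bounded_ops_linear])+
    show "nrm ((S \<circ> T) x) \<le> (A * B) * nrm x" for x
      using order_trans[OF A(2)[of "T x"] mult_left_mono[OF B[of x] A(1)]] by (simp add: mult.assoc)
  qed
qed

lemma bounded_ops_diff: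
  assumes "S \<in> bounded_ops" "T \<in> bounded_ops"
  shows "(\<lambda>x. S x - T x) \<in> bounded_ops"
proof -
  interpret S: Vector_Spaces.linear cscale cscale S using assms(1) by (rule bounded_ops_linear)
  interpret T: Vector_Spaces.linear cscale cscale T using assms(2) by (rule bounded_ops_linear)
  obtain A B where A: "\<And>x. nrm (S x) \<le> A * nrm x" and B: "\<And>x. nrm (T x) \<le> B * nrm x"
    using assms unfolding bounded_ops_iff by blast
  show ?thesis
  proof (rule bounded_opsI)
    show "Vector_Spaces.linear cscale cscale (\<lambda>x. S x - T x)"
      by (rule linearI) (simp_all add: S.add T.add S.scale T.scale scale_right_diff_distrib)
    show "nrm (S x - T x) \<le> (A + B) * nrm x" for x
      using N.nrm_diff_le[of "S x" "T x"] A[of x] B[of x] by (simp add: distrib_right)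
  qed
qed

lemma bounded_ops_ident: "(\<lambda>x. x) \<in> bounded_ops"
  by (rule bounded_opsI[of _ 1]) (simp_all add: linear_ident)

lemma bounded_ops_limit:
  assumes "T \<in> bounded_ops" "(\<lambda>n. nrm (s n - x)) \<longlonglongrightarrow> 0"
  shows "(\<lambda>n. nrm (T (s n) - T x)) \<longlonglongrightarrow> 0"
proof -
  interpret T: Vector_Spaces.linear cscale cscale T using assms(1) by (rule bounded_ops_linear)
  obtain C where C: "\<And>x. nrm (T x) \<le> C * nrm x"
    using assms(1) unfolding bounded_ops_iff by blast
  have "(\<lambda>n. C * nrm (s n - x)) \<longlonglongrightarrow> C * 0"
    by (intro tendsto_intros assms)
  then have "(\<lambda>n. C * nrm (s n - x)) \<longlonglongrightarrow> 0" by simp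
  then show ?thesis
    by (rule Lim_null_comparison[rotated]) (use C[of "s _ - x"] in \<open>simp add: T.diff\<close>)
qed

lemma form_limit_left:
  assumes "(\<lambda>n. nrm (s n - x)) \<longlonglongrightarrow> 0" "\<And>n. form (s n) y = 0"
  shows "form x y = 0"
proof -
  have "(\<lambda>n. nrm (s n - x) * nrm y) \<longlonglongrightarrow> 0 * nrm y"
    by (intro tendsto_intros assms)
  moreover have "cmod (form x y) \<le> nrm (s n - x) * nrm y" for n
    using form_le[of "s n - x" y] assms(2)[of n] by (simp add: form_simps)
  ultimately have "cmod (form x y) \<le> 0 * nrm y"
    by (intro LIMSEQ_le_const) auto
  then show ?thesis by simp
qed

text \<open>Closedness may be witnessed by another decomposition; convergence in \<open>nrm\<close>
  implies convergence in its norm, so sequential closedness carries over.\<close>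

lemma closed_range_limit:
  assumes "T \<in> closed_range_ops" "(\<lambda>n. nrm (s n - x)) \<longlonglongrightarrow> 0" "\<And>n. s n \<in> range T"
  shows "x \<in> range T"
proof -
  obtain P' M' where P'M': "fundamental_decomposition P' M'" "closedin (fd_topology P' M') (range T)"
    using assms(1) by (auto simp: closed_range_ops_def)
  interpret F: fundamental cscale form P' M' by unfold_locales fact
  have top: "fd_topology P' M' = F.N.mtopology"
    by (simp add: fd_topology_def form_dist_def[abs_def] fd_norm_def)
  obtain A where A: "\<And>x. F.nrm x \<le> A * nrm x"
    using equivalent[OF P'M'(1)] by blast
  have "(\<lambda>n. A * nrm (s n - x)) \<longlonglongrightarrow> A * 0"
    by (intro tendsto_intros assms)
  then have "(\<lambda>n. A * nrm (s n - x)) \<longlonglongrightarrow> 0" by simp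
  then have "(\<lambda>n. F.nrm (s n - x)) \<longlonglongrightarrow> 0"
    by (rule Lim_null_comparison[rotated]) (simp add: A)
  then have "limitin F.N.mtopology s x sequentially"
    by (simp add: F.N.limitin_iff)
  then show ?thesis
    using P'M'(2) assms(3) unfolding top F.N.metric_closedin_iff_sequentially_closed by blast
qed

lemma uniformly_positiveD:
  assumes "uniformly_positive S"
  shows "\<exists>\<epsilon>>0. \<forall>s\<in>S. \<epsilon> * (nrm s)\<^sup>2 \<le> Re (form s s)"
proof -
  obtain P' M' \<delta> where P'M': "fundamental_decomposition P' M'"
    and \<delta>: "0 < \<delta>" "\<And>s. s \<in> S \<Longrightarrow> \<delta> * (fd_norm P' M' s)\<^sup>2 \<le> Re (form s s)"
    using assms by (auto simp: uniformly_positive_def)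
  interpret F: fundamental cscale form P' M' by unfold_locales fact
  obtain A where A: "0 < A" "\<And>x. nrm x \<le> A * F.nrm x"
    using equivalent[OF P'M'] by blast
  \<comment> \<open>The change of norm costs a factor \<open>A\<close>, which is squared together
    with the norm.\<close>
  have "\<delta> / A\<^sup>2 * (nrm s)\<^sup>2 \<le> Re (form s s)" if "s \<in> S" for s
  proof -
    have "(nrm s)\<^sup>2 \<le> (A * F.nrm s)\<^sup>2"
      by (intro power_mono A(2)) simp
    then have "\<delta> / A\<^sup>2 * (nrm s)\<^sup>2 \<le> \<delta> / A\<^sup>2 * (A * F.nrm s)\<^sup>2"
      using \<delta>(1) by (intro mult_left_mono) auto
    also have "\<dots> = \<delta> * (F.nrm s)\<^sup>2"
      using A(1) by (simp add: power_mult_distrib)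
    also have "\<dots> \<le> Re (form s s)"
      by (rule \<delta>(2)[OF that])
    finally show ?thesis .
  qed
  moreover have "0 < \<delta> / A\<^sup>2" using \<delta>(1) A(1) by simp
  ultimately show ?thesis by blast
qed

text \<open>Riesz represents \<open>x \<mapsto> [Tx, y]\<close> by the inner product, and
  \<open>J\<close> converts this to the form. The vectors are chosen separately for each
  \<open>y\<close>; linearity follows from nondegeneracy.\<close>

lemma adjoint_exists:
  assumes "T \<in> bounded_ops"
  shows "\<exists>S\<in>bounded_ops. \<forall>x y. form (T x) y = form x (S y)"
proof -
  interpret T: Vector_Spaces.linear cscale cscale T using assms by (rule bounded_ops_linear)
  obtain C where C: "\<And>x. nrm (T x) \<le> C * nrm x"
    using assms unfolding bounded_ops_iff by blast
  have "\<exists>u. \<forall>x. form (T x) y = form x u" for y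
  proof -
    have le: "cmod (form (T x) y) \<le> (C * nrm y) * form_norm inner x" for x
    proof -
      have "cmod (form (T x) y) \<le> nrm (T x) * nrm y" by (rule form_le)
      also have "\<dots> \<le> (C * nrm x) * nrm y" by (intro mult_right_mono C) simp
      finally show ?thesis by (simp add: fd_norm_def ac_simps)
    qed
    have "\<exists>u\<in>UNIV. \<forall>x\<in>UNIV. form (T x) y = inner x u"
      by (rule H.riesz_representation[where C = "C * nrm y"]) (simp_all add: T.add T.scale form_simps le)
    then obtain u where "\<And>x. form (T x) y = inner x u" by blast
    then have "\<forall>x. form (T x) y = form x (J u)" by (simp add: form_J)
    then show ?thesis ..
  qed
  then obtain S where "\<forall>y x. form (T x) y = form x (S y)"
    using choice[of "\<lambda>y u. \<forall>x. form (T x) y = form x u"] by blast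
  then have S: "form (T x) y = form x (S y)" for x y by blast
  have "S \<in> bounded_ops"
  proof (rule bounded_opsI)
    show "Vector_Spaces.linear cscale cscale S"
    proof (rule linearI)
      show "S (x + y) = S x + S y" for x y
        by (rule form_right_eqI) (simp add: S[symmetric] form_simps)
      show "S (cscale c x) = cscale c (S x)" for c x
        by (rule form_right_eqI) (simp add: S[symmetric] form_simps)
    qed
    fix y
    show "nrm (S y) \<le> C * nrm y"
    proof (cases "nrm (S y) = 0")
      case True
      have "0 \<le> C * nrm y" using order_trans[OF N.nrm_ge_0 C] .
      with True show ?thesis by simp
    next
      case False
      then have pos: "0 < nrm (S y)" using N.nrm_ge_0[of "S y"] by linarith
      \<comment> \<open>Testing the adjoint relation with \<open>J (S y)\<close> produces the
        Hilbert norm of \<open>S y\<close>, one factor of which cancels.\<close>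
      have "(nrm (S y))\<^sup>2 = Re (form (T (J (S y))) y)"
        by (simp add: nrm_square_eq S form_J)
      also have "\<dots> \<le> nrm (T (J (S y))) * nrm y"
        using complex_Re_le_cmod form_le by (rule order_trans)
      also have "\<dots> \<le> (C * nrm (J (S y))) * nrm y"
        by (intro mult_right_mono C) simp
      finally have "nrm (S y) * nrm (S y) \<le> nrm (S y) * (C * nrm y)"
        by (simp add: nrm_J power2_eq_square ac_simps)
      then show ?thesis using pos by simp
    qed
  qed
  with S show ?thesis by blast
qed

lemma adj_eqI:
  assumes "S \<in> bounded_ops" "\<And>x y. form (T x) y = form x (S y)"
  shows "adj T = S"
  unfolding adj_def
proof (rule the_equality)
  show "S \<in> bounded_ops \<and> (\<forall>x y. form (T x) y = form x (S y))" using assms by blast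
  show "S' = S" if "S' \<in> bounded_ops \<and> (\<forall>x y. form (T x) y = form x (S' y))" for S'
  proof
    show "S' y = S y" for y
      using that assms(2) by (intro form_right_eqI) metis
  qed
qed

lemma form_adj:
  assumes "T \<in> bounded_ops"
  shows "form (T x) y = form x (adj T y)"
  using adjoint_exists[OF assms] adj_eqI by metis

text \<open>Since \<open>[adj U (U x), x] = [Ux, Ux]\<close> is real, the order between Gram
  operators is a pointwise comparison of squares, and adjoints disappear from the minimality
  arguments.\<close>

lemma op_le_gram_iff:
  assumes "S \<in> bounded_ops" "T \<in> bounded_ops"
  shows "op_le (gram S) (gram T) \<longleftrightarrow> (\<forall>x. Re (form (S x) (S x)) \<le> Re (form (T x) (T x)))"
proof -
  have "form (adj U (U x)) x = form (U x) (U x)" if "U \<in> bounded_ops" for U x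
  proof -
    have "form (adj U (U x)) x = cnj (form (U x) (U x))"
      by (subst form_commute) (simp add: form_adj[OF that])
    also have "\<dots> = form (U x) (U x)"
      by (rule form_commute[symmetric])
    finally show ?thesis .
  qed
  then show ?thesis
    using assms by (simp add: op_le_def gram_def form_diff_left complex_nonneg_Reals_iff)
qed

text \<open>
  The form restricted to a closed uniformly positive subspace is a Hilbert space inner product,
  so the orthogonal projection onto it comes from Riesz representation.
\<close>

lemma projection_exists:
  assumes up: "uniformly_positive S"
    and closed: "\<And>s x. (\<lambda>n. nrm (s n - x)) \<longlonglongrightarrow> 0 \<Longrightarrow> (\<And>n. s n \<in> S) \<Longrightarrow> x \<in> S"
  shows "\<exists>Q\<in>bounded_ops. \<forall>x. Q x \<in> S \<and> (\<forall>s\<in>S. form s (Q x) = form s x)"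
proof -
  obtain \<epsilon> where "0 < \<epsilon> \<and> (\<forall>s\<in>S. \<epsilon> * (nrm s)\<^sup>2 \<le> Re (form s s))"
    using uniformly_positiveD[OF up] by (rule exE)
  then have \<epsilon>: "0 < \<epsilon>" "s \<in> S \<Longrightarrow> \<epsilon> * (nrm s)\<^sup>2 \<le> Re (form s s)" for s
    by blast+
  have nonneg: "0 \<le> Re (form s s)" if "s \<in> S" for s
  proof (rule order_trans)
    show "0 \<le> \<epsilon> * (nrm s)\<^sup>2" using \<epsilon>(1) by simp
  qed (rule \<epsilon>(2)[OF that])
  interpret S: positive_subspace cscale form S
  proof
    show "subspace S" using up unfolding uniformly_positive_def by (rule conjunct1)
    show "form x x \<in> \<real>\<^sub>\<ge>\<^sub>0" if "x \<in> S" for x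
      using nonneg[OF that] by (simp add: complex_nonneg_Reals_iff)
    show "x = 0" if "x \<in> S" "form x x = 0" for x
    proof -
      have "\<epsilon> * (nrm x)\<^sup>2 \<le> 0" using \<epsilon>(2)[OF that(1)] unfolding that(2) by simp
      then have "nrm x = 0"
        using \<epsilon>(1) by (simp add: mult_le_0_iff)
      then show ?thesis by (rule N.nrm_eq_0)
    qed
  qed
  \<comment> \<open>With \<open>upper\<close> this makes the two norms equivalent on
    \<open>S\<close>: Cauchy sequences pass to \<open>nrm\<close> by the first bound, limits come
    back by the second.\<close>
  have lower: "nrm s \<le> form_norm form s / sqrt \<epsilon>" if "s \<in> S" for s
  proof -
    have "(sqrt \<epsilon> * nrm s)\<^sup>2 = \<epsilon> * (nrm s)\<^sup>2"
      using \<epsilon>(1) by (simp add: power_mult_distrib)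
    also have "\<dots> \<le> (form_norm form s)\<^sup>2"
      using \<epsilon>(2)[OF that] S.form_norm_square[OF that] by simp
    finally have "sqrt \<epsilon> * nrm s \<le> form_norm form s"
      by (rule power2_le_imp_le) simp
    then show ?thesis using \<epsilon>(1) by (simp add: field_simps)
  qed
  have upper: "form_norm form x \<le> nrm x" for x
  proof (rule power2_le_imp_le)
    show "(form_norm form x)\<^sup>2 \<le> (nrm x)\<^sup>2"
      using form_le[of x x] by (simp add: form_norm_def power2_eq_square)
  qed simp
  interpret S: hilbert_subspace cscale form S
  proof
    fix s :: "nat \<Rightarrow> 'a"
    assume S: "\<And>n. s n \<in> S"
      and cauchy: "\<And>e. 0 < e \<Longrightarrow> \<exists>K. \<forall>m\<ge>K. \<forall>n\<ge>K. form_norm form (s m - s n) < e"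
    have nrm_cauchy: "\<exists>K. \<forall>m\<ge>K. \<forall>n\<ge>K. nrm (s m - s n) < e" if "0 < e" for e
    proof -
      obtain K where K: "\<And>m n. K \<le> m \<Longrightarrow> K \<le> n \<Longrightarrow> form_norm form (s m - s n) < sqrt \<epsilon> * e"
        using cauchy[of "sqrt \<epsilon> * e"] \<open>0 < e\<close> \<epsilon>(1) by auto
      have "nrm (s m - s n) < e" if "K \<le> m" "K \<le> n" for m n
      proof -
        have "nrm (s m - s n) \<le> form_norm form (s m - s n) / sqrt \<epsilon>"
          using S by (intro lower) simp
        also have "\<dots> < e" using K[OF that] \<epsilon>(1) by (simp add: field_simps)
        finally show ?thesis .
      qed
      then show ?thesis by blast
    qed
    obtain x where x: "(\<lambda>n. nrm (s n - x)) \<longlonglongrightarrow> 0"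
      using N.cauchy_convergent[OF nrm_cauchy] by (rule exE)
    moreover have "(\<lambda>n. form_norm form (s n - x)) \<longlonglongrightarrow> 0"
      using x by (rule Lim_null_comparison[rotated]) (simp add: upper)
    ultimately show "\<exists>x\<in>S. (\<lambda>n. form_norm form (s n - x)) \<longlonglongrightarrow> 0"
      by (intro bexI[of _ x] closed[OF x S])
  qed
  have "\<exists>u. u \<in> S \<and> (\<forall>s\<in>S. form s u = form s x)" for x
  proof -
    have le: "cmod (form s x) \<le> (nrm x / sqrt \<epsilon>) * form_norm form s" if "s \<in> S" for s
    proof -
      have "cmod (form s x) \<le> nrm s * nrm x" by (rule form_le)
      also have "\<dots> \<le> form_norm form s / sqrt \<epsilon> * nrm x"
        using lower[OF that] by (rule mult_right_mono) simp
      finally show ?thesis by (simp add: ac_simps)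
    qed
    have "\<exists>u\<in>S. \<forall>s\<in>S. form s x = form s u"
      by (rule S.riesz_representation[where C = "nrm x / sqrt \<epsilon>"]) (use le in \<open>simp_all add: form_simps\<close>)
    then obtain u where "u \<in> S" "\<forall>s\<in>S. form s x = form s u" ..
    then show ?thesis by auto
  qed
  then obtain Q where "\<forall>x. Q x \<in> S \<and> (\<forall>s\<in>S. form s (Q x) = form s x)"
    using choice[of "\<lambda>x u. u \<in> S \<and> (\<forall>s\<in>S. form s u = form s x)"] by blast
  then have Q: "Q x \<in> S" "s \<in> S \<Longrightarrow> form s (Q x) = form s x" for x s by blast+
  \<comment> \<open>The values of \<open>Q\<close> are chosen point by point, so its linearity must
    come from uniqueness.\<close>
  have unique: "u = v" if "u \<in> S" "v \<in> S" "\<And>s. s \<in> S \<Longrightarrow> form s u = form s v" for u v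
  proof -
    have "form (u - v) (u - v) = 0"
      using that by (simp add: form_diff_right)
    then show ?thesis using S.definite[of "u - v"] that by simp
  qed
  have "Q \<in> bounded_ops"
  proof (rule bounded_opsI)
    show "Vector_Spaces.linear cscale cscale Q"
    proof (rule linearI)
      show "Q (x + y) = Q x + Q y" for x y
        by (rule unique) (simp_all add: Q form_add_right)
      show "Q (cscale c x) = cscale c (Q x)" for c x
        by (rule unique) (simp_all add: Q form_scale_right)
    qed
    fix x
    \<comment> \<open>Testing \<open>Q x\<close> against itself gives
      \<open>[Qx, Qx] = [Qx, x]\<close>; cancelling \<open>nrm (Q x)\<close> leaves the bound
      \<open>1 / \<epsilon>\<close>.\<close>
    have "\<epsilon> * (nrm (Q x))\<^sup>2 \<le> Re (form (Q x) (Q x))" by (rule \<epsilon>(2)[OF Q(1)])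
    also have "\<dots> \<le> cmod (form (Q x) x)"
      using complex_Re_le_cmod[of "form (Q x) x"] by (simp add: Q)
    also have "\<dots> \<le> nrm (Q x) * nrm x" by (rule form_le)
    finally have le: "nrm (Q x) * (\<epsilon> * nrm (Q x)) \<le> nrm (Q x) * nrm x"
      by (simp add: power2_eq_square ac_simps)
    show "nrm (Q x) \<le> (1 / \<epsilon>) * nrm x"
    proof (cases "nrm (Q x) = 0")
      case True
      then show ?thesis using \<epsilon>(1) by simp
    next
      case False
      then have "0 < nrm (Q x)" using N.nrm_ge_0[of "Q x"] by linarith
      with le have "\<epsilon> * nrm (Q x) \<le> nrm x" by simp
      then show ?thesis using \<epsilon>(1) by (simp add: field_simps)
    qed
  qed
  then show ?thesis using Q by blast
qed

end

section \<open>Indefinite minimum solutions\<close>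

context fundamental
begin

text \<open>Minimality arguments deliver an inequality, so the premise is \<open>\<le> 0\<close>
  instead of \<open>= 0\<close>; this also yields nonnegativity.\<close>

lemma uniformly_positive_definite:
  assumes "uniformly_positive S" "s \<in> S" "Re (form s s) \<le> 0"
  shows "s = 0"
proof -
  obtain \<epsilon> where \<epsilon>: "0 < \<epsilon>" "\<forall>s\<in>S. \<epsilon> * (nrm s)\<^sup>2 \<le> Re (form s s)"
    using uniformly_positiveD[OF assms(1)] by blast
  have "\<epsilon> * (nrm s)\<^sup>2 \<le> 0"
    using order_trans[OF \<epsilon>(2)[rule_format, OF assms(2)] assms(3)] .
  then have "nrm s = 0" using \<epsilon>(1) by (simp add: mult_le_0_iff)
  then show ?thesis by (rule N.nrm_eq_0)
qed

lemma uniformly_positive_nonneg: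
  assumes "uniformly_positive S" "s \<in> S"
  shows "0 \<le> Re (form s s)"
  using uniformly_positive_definite[OF assms] by (cases "0 \<le> Re (form s s)") auto

lemma pythagoras:
  assumes "form u v = 0"
  shows "form (u + v) (u + v) = form u u + form v v"
  using assms form_commute[of u v] by (simp add: form_simps)

text \<open>\<open>B D1\<close> and \<open>B D2\<close> are self-adjoint projections with the same
  range, which forces equality; likewise \<open>D1 B\<close> and \<open>D2 B\<close> have the same
  null space. Nondegeneracy of the form turns equal pairings into equal vectors.\<close>

lemma moore_penrose_inverse_unique:
  assumes B: "B \<in> bounded_ops"
    and D1: "is_moore_penrose_inverse B D1" and D2: "is_moore_penrose_inverse B D2"
  shows "D1 = D2"
proof
  have BDB: "B (D (B x)) = B x" and DBD: "D (B (D x)) = D x"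
    and BD: "form (B (D x)) y = form x (B (D y))" and DB: "form (D (B x)) y = form x (D (B y))"
    if D: "is_moore_penrose_inverse B D" for D x y
  proof -
    have bounded: "B \<circ> D \<in> bounded_ops" "D \<circ> B \<in> bounded_ops"
      using B D by (auto simp: is_moore_penrose_inverse_def intro: bounded_ops_comp)
    have "B \<circ> D \<circ> B = B" "D \<circ> B \<circ> D = D"
      using D unfolding is_moore_penrose_inverse_def by blast+
    from this[THEN fun_cong, of x] show "B (D (B x)) = B x" "D (B (D x)) = D x"
      by simp_all
    show "form (B (D x)) y = form x (B (D y))" "form (D (B x)) y = form x (D (B y))"
      using form_adj[OF bounded(1), of x y] form_adj[OF bounded(2), of x y] D
      by (simp_all add: is_moore_penrose_inverse_def)
  qed
  fix x
  have BD_eq: "B (D1 x) = B (D2 x)" for x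
  proof (rule form_right_eqI)
    fix z
    have "form z (B (D1 x)) = form (B (D1 z)) x" by (rule BD[OF D1, symmetric])
    also have "\<dots> = form (B (D2 (B (D1 z)))) x" by (simp only: BDB[OF D2])
    also have "\<dots> = form z (B (D1 (B (D2 x))))" by (simp only: BD[OF D1] BD[OF D2])
    also have "\<dots> = form z (B (D2 x))" by (simp only: BDB[OF D1])
    finally show "form z (B (D1 x)) = form z (B (D2 x))" .
  qed
  have DB_eq: "D1 (B x) = D2 (B x)" for x
  proof (rule form_right_eqI)
    fix z
    have "form z (D1 (B x)) = form z (D1 (B (D2 (B x))))" by (simp only: BDB[OF D2])
    also have "\<dots> = form (D2 (B (D1 (B z)))) x" by (simp only: DB[OF D1] DB[OF D2])
    also have "\<dots> = form (D2 (B z)) x" by (simp only: BDB[OF D1])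
    also have "\<dots> = form z (D2 (B x))" by (rule DB[OF D2])
    finally show "form z (D1 (B x)) = form z (D2 (B x))" .
  qed
  \<comment> \<open>The chain is \<open>D1 = D1 B D1 = D1 B D2 = D2 B D2 = D2\<close>.\<close>
  have "D1 x = D1 (B (D1 x))" by (simp only: DBD[OF D1])
  also have "\<dots> = D2 (B (D2 x))" by (simp only: BD_eq DB_eq)
  also have "\<dots> = D2 x" by (simp only: DBD[OF D2])
  finally show "D1 x = D2 x" .
qed

end

section \<open>Construction of the least squares inverse\<close>

locale uniformly_positive_operator = fundamental +
  fixes B
  assumes closed_range: "B \<in> closed_range_ops"
    and null_space: "uniformly_positive {x. B x = 0}"
    and range: "uniformly_positive (range B)"
begin

lemma bounded: "B \<in> bounded_ops"
  using closed_range by (simp add: closed_range_ops_def)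

sublocale B: Vector_Spaces.linear cscale cscale B
  by (rule bounded_ops_linear[OF bounded])

text \<open>\<open>uniformly_positive\<close> does not include closedness, which the projection
  requires: here it is continuity of \<open>B\<close>, for the range it is the closed range
  assumption.\<close>

lemma null_space_limit:
  assumes "(\<lambda>n. nrm (s n - x)) \<longlonglongrightarrow> 0" "\<And>n. s n \<in> {x. B x = 0}"
  shows "x \<in> {x. B x = 0}"
proof -
  have "B (s n) = 0" for n using assms(2)[of n] by simp
  then have "(\<lambda>n. nrm (0 - B x)) \<longlonglongrightarrow> 0"
    using bounded_ops_limit[OF bounded assms(1)] by simp
  then have "nrm (0 - B x) = 0" by (simp only: LIMSEQ_const_iff)
  then have "0 - B x = 0" by (rule N.nrm_eq_0)
  then show ?thesis by simp
qed

lemma range_limit: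
  assumes "(\<lambda>n. nrm (s n - x)) \<longlonglongrightarrow> 0" "\<And>n. s n \<in> range B"
  shows "x \<in> range B"
  using closed_range_limit[OF closed_range assms] .

lemma null_space_definite: "B n = 0 \<Longrightarrow> Re (form n n) \<le> 0 \<Longrightarrow> n = 0"
  by (rule uniformly_positive_definite[OF null_space]) simp_all

lemma range_definite: "r \<in> range B \<Longrightarrow> Re (form r r) \<le> 0 \<Longrightarrow> r = 0"
  by (rule uniformly_positive_definite[OF range])

text \<open>The first condition is the normal equation: \<open>B (D x)\<close> is the projection of
  \<open>x\<close> onto \<open>R(B)\<close>. The second selects, among the preimages of that
  projection, the one orthogonal to \<open>N(B)\<close>.\<close>

lemma least_squares_inverse_exists:
  "\<exists>D\<in>bounded_ops. (\<forall>x y. form (B y) (B (D x)) = form (B y) x) \<and> (\<forall>n x. B n = 0 \<longrightarrow> form n (D x) = 0)"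
proof -
  have range_projection:
    "\<exists>Q\<in>bounded_ops. \<forall>x. Q x \<in> range B \<and> (\<forall>s\<in>range B. form s (Q x) = form s x)"
    by (rule projection_exists[OF range]) (fact range_limit)
  obtain Q where Q: "Q \<in> bounded_ops" "\<forall>x. Q x \<in> range B \<and> (\<forall>s\<in>range B. form s (Q x) = form s x)"
    using range_projection by blast
  have "\<exists>E\<in>bounded_ops. \<forall>x. E x \<in> {x. B x = 0} \<and> (\<forall>s\<in>{x. B x = 0}. form s (E x) = form s x)"
    by (rule projection_exists[OF null_space]) (fact null_space_limit)
  then obtain E where E: "\<forall>x. B (E x) = 0 \<and> (\<forall>n. B n = 0 \<longrightarrow> form n (E x) = form n x)"
    by auto
  have "\<exists>u. B u = Q x \<and> (\<forall>n. B n = 0 \<longrightarrow> form n u = 0)" for x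
  proof -
    obtain v where "Q x = B v" using Q(2) by blast
    \<comment> \<open>Removing from any preimage its projection onto \<open>N(B)\<close> keeps the
      image and makes it orthogonal to \<open>N(B)\<close>.\<close>
    then have "B (v - E v) = Q x \<and> (\<forall>n. B n = 0 \<longrightarrow> form n (v - E v) = 0)"
      using E by (simp add: B.diff form_diff_right)
    then show ?thesis ..
  qed
  then obtain D where "\<forall>x. B (D x) = Q x \<and> (\<forall>n. B n = 0 \<longrightarrow> form n (D x) = 0)"
    using choice[of "\<lambda>x u. B u = Q x \<and> (\<forall>n. B n = 0 \<longrightarrow> form n u = 0)"] by blast
  then have D: "B (D x) = Q x" "B n = 0 \<Longrightarrow> form n (D x) = 0" for x n
    by blast+
  \<comment> \<open>The difference of two such preimages lies in \<open>N(B)\<close> and is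
    orthogonal to \<open>N(B)\<close>, hence to itself.\<close>
  have unique: "u = v" if "B u = B v" "\<And>n. B n = 0 \<Longrightarrow> form n u = 0" "\<And>n. B n = 0 \<Longrightarrow> form n v = 0" for u v
  proof -
    have "B (u - v) = 0" using that(1) by (simp add: B.diff)
    then have "form (u - v) (u - v) = 0"
      using that(2,3)[of "u - v"] by (simp add: form_diff_right)
    then show ?thesis using null_space_definite[OF \<open>B (u - v) = 0\<close>] by simp
  qed
  interpret Q: Vector_Spaces.linear cscale cscale Q by (rule bounded_ops_linear[OF Q(1)])
  have linear: "Vector_Spaces.linear cscale cscale D"
  proof (rule linearI)
    show "D (x + y) = D x + D y" for x y
      by (rule unique) (simp_all add: D B.add Q.add form_add_right)
    show "D (cscale c x) = cscale c (D x)" for c x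
      by (rule unique) (simp_all add: D B.scale Q.scale form_scale_right)
  qed
  \<comment> \<open>Both conditions that determine \<open>D x\<close> survive limits, the image by
    continuity of \<open>B\<close> and \<open>Q\<close>, the orthogonality by continuity of the
    form; so the graph is closed.\<close>
  have "\<exists>C. \<forall>x. nrm (D x) \<le> C * nrm x"
  proof (rule closed_graph[OF N.complete_norm_axioms N.complete_norm_axioms linear])
    fix s x y
    assume s: "(\<lambda>n. nrm (s n - x)) \<longlonglongrightarrow> 0" and Ds: "(\<lambda>n. nrm (D (s n) - y)) \<longlonglongrightarrow> 0"
    show "D x = y"
    proof (rule unique)
      have "(\<lambda>n. nrm (Q (s n) - B y)) \<longlonglongrightarrow> 0"
        using bounded_ops_limit[OF bounded Ds] by (simp only: D)
      then show "B (D x) = B y"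
        unfolding D by (rule N.limit_unique[OF bounded_ops_limit[OF Q(1) s]])
      show "form n (D x) = 0" if "B n = 0" for n using that by (rule D)
      show "form n y = 0" if "B n = 0" for n
      proof -
        have "form (D (s k)) n = 0" for k
          using D(2)[OF that, of "s k"] form_commute[of n "D (s k)"] by simp
        with Ds have "form y n = 0" by (rule form_limit_left)
        then show ?thesis using form_commute[of y n] by simp
      qed
    qed
  qed
  then obtain C where C: "\<forall>x. nrm (D x) \<le> C * nrm x" ..
  have "D \<in> bounded_ops" using linear C[rule_format] by (rule bounded_opsI)
  moreover have "form (B y) (B (D x)) = form (B y) x" for x y
    using Q(2) by (simp add: D)
  ultimately show ?thesis using D(2) by blast
qed

section \<open>Consequences of the two equations for the inverse\<close>

context
  fixes D
  assumes D: "D \<in> bounded_ops"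
    and normal_equation: "form (B y) (B (D x)) = form (B y) x"
    and null_orthogonal: "B n = 0 \<Longrightarrow> form n (D x) = 0"
begin

text \<open>By the normal equation \<open>B (D (B x) - x)\<close> is orthogonal to
  \<open>R(B)\<close>, in which it lies.\<close>

lemma B_D_B: "B (D (B x)) = B x"
proof -
  have "form (B (D (B x) - x)) (B (D (B x) - x)) = 0"
    by (simp add: B.diff form_diff_right normal_equation form_diff_left)
  then have "B (D (B x) - x) = 0" by (intro range_definite) simp_all
  then show ?thesis by (simp add: B.diff)
qed

lemma is_moore_penrose_inverse: "is_moore_penrose_inverse B D"
  unfolding is_moore_penrose_inverse_def
proof (intro conjI)
  show "D \<in> bounded_ops" by (rule D)
  show "B \<circ> D \<circ> B = B" by (rule ext) (simp add: B_D_B)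
  show "D \<circ> B \<circ> D = D"
  proof
    fix x
    \<comment> \<open>The difference lies in \<open>N(B)\<close>, while both of its terms are values
      of \<open>D\<close> and so orthogonal to \<open>N(B)\<close>.\<close>
    have null: "B (D (B (D x)) - D x) = 0" by (simp add: B.diff B_D_B)
    have "form (D (B (D x)) - D x) (D (B (D x)) - D x) = 0"
      by (simp add: form_diff_right null_orthogonal[OF null])
    then have "D (B (D x)) - D x = 0" by (intro null_space_definite[OF null]) simp
    then show "(D \<circ> B \<circ> D) x = D x" by simp
  qed
  show "adj (B \<circ> D) = B \<circ> D"
  proof (rule adj_eqI)
    show "B \<circ> D \<in> bounded_ops" by (rule bounded_ops_comp[OF bounded D])
    fix x y
    have "form (B (D x)) y = form (B (D x)) (B (D y))" by (rule normal_equation[symmetric])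
    also have "\<dots> = cnj (form (B (D y)) (B (D x)))" by (rule form_commute)
    also have "\<dots> = cnj (form (B (D y)) x)" by (simp only: normal_equation)
    also have "\<dots> = form x (B (D y))" by (rule form_commute[symmetric])
    finally show "form ((B \<circ> D) x) y = form x ((B \<circ> D) y)" by simp
  qed
  show "adj (D \<circ> B) = D \<circ> B"
  proof (rule adj_eqI)
    show "D \<circ> B \<in> bounded_ops" by (rule bounded_ops_comp[OF D bounded])
    fix x y
    \<comment> \<open>\<open>z - D (B z)\<close> belongs to \<open>N(B)\<close>, hence is orthogonal
      to the values of \<open>D\<close>. Used once in each argument, this moves \<open>D B\<close>
      across the form.\<close>
    have null: "form (z - D (B z)) (D w) = 0" for z w
      by (rule null_orthogonal) (simp add: B.diff B_D_B)
    have "form (D (B x)) (y - D (B y)) = cnj (form (y - D (B y)) (D (B x)))"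
      by (rule form_commute)
    then have "form (D (B x)) y = form (D (B x)) (D (B y))"
      by (simp add: null form_diff_right)
    also have "\<dots> = form x (D (B y))"
      using null[of x "B y"] by (simp add: form_diff_left)
    finally show "form ((D \<circ> B) x) y = form x ((D \<circ> B) y)" by simp
  qed
qed

lemma moore_penrose_inverse_eq: "moore_penrose_inverse B = D"
  unfolding moore_penrose_inverse_def
  using is_moore_penrose_inverse moore_penrose_inverse_unique[OF bounded _ is_moore_penrose_inverse]
  by (rule the_equality)

lemma residual_split:
  "Re (form (B y - x) (B y - x))
    = Re (form (B y - B (D x)) (B y - B (D x))) + Re (form (B (D x) - x) (B (D x) - x))"
proof -
  have "form (B (y - D x)) (B (D x) - x) = 0"
    by (simp only: form_diff_right normal_equation) simp
  from pythagoras[OF this] show ?thesis by (simp add: B.diff)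
qed

text \<open>\<open>D\<close> is an admissible competitor that minimizes the residual at all
  \<open>x\<close> simultaneously, so comparison with it alone pins down \<open>B X\<close>.\<close>

lemma indefinite_min_solution_iff:
  "indefinite_min_solution B X \<longleftrightarrow> X \<in> bounded_ops \<and> (\<forall>x. B (X x) = B (D x))"
proof -
  have res: "(\<lambda>x. B (X x) - x) \<in> bounded_ops" if "X \<in> bounded_ops" for X
    using bounded_ops_diff[OF bounded_ops_comp[OF bounded that] bounded_ops_ident] by simp
  have sq: "0 \<le> Re (form (B (Y x) - B (D x)) (B (Y x) - B (D x)))" for x and Y :: "'a \<Rightarrow> 'a"
    using uniformly_positive_nonneg[OF range rangeI[of B "Y x - D x"]] by (simp add: B.diff)
  have "indefinite_min_solution B X \<longleftrightarrow> X \<in> bounded_ops \<and> (\<forall>Y\<in>bounded_ops. \<forall>x.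
      Re (form (B (X x) - x) (B (X x) - x)) \<le> Re (form (B (Y x) - x) (B (Y x) - x)))"
    unfolding indefinite_min_solution_def by (intro conj_cong ball_cong refl op_le_gram_iff res)
  also have "\<dots> \<longleftrightarrow> X \<in> bounded_ops \<and> (\<forall>x. B (X x) = B (D x))"
  proof (intro conj_cong refl iffI allI ballI)
    fix x
    assume "\<forall>Y\<in>bounded_ops. \<forall>x. Re (form (B (X x) - x) (B (X x) - x)) \<le> Re (form (B (Y x) - x) (B (Y x) - x))"
    then have "Re (form (B (X x) - x) (B (X x) - x)) \<le> Re (form (B (D x) - x) (B (D x) - x))"
      using D by blast
    then have "Re (form (B (X x - D x)) (B (X x - D x))) \<le> 0"
      using residual_split[of "X x" x] by (simp add: B.diff)
    then have "B (X x - D x) = 0" by (intro range_definite) simp_all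
    then show "B (X x) = B (D x)" by (simp add: B.diff)
  next
    fix Y x
    assume "\<forall>x. B (X x) = B (D x)"
    then show "Re (form (B (X x) - x) (B (X x) - x)) \<le> Re (form (B (Y x) - x) (B (Y x) - x))"
      using residual_split[of "Y x" x] sq[of Y x] by simp
  qed
  finally show ?thesis .
qed

lemma indefinite_min_solution_split:
  assumes "indefinite_min_solution B Y"
  shows "B (Y x - D x) = 0"
    and "Re (form (Y x) (Y x)) = Re (form (Y x - D x) (Y x - D x)) + Re (form (D x) (D x))"
proof -
  show null: "B (Y x - D x) = 0"
    using assms by (simp add: indefinite_min_solution_iff B.diff)
  show "Re (form (Y x) (Y x)) = Re (form (Y x - D x) (Y x - D x)) + Re (form (D x) (D x))"
    using pythagoras[OF null_orthogonal[OF null, of x]] by simp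
qed

lemma minimal_solution_iff:
  "indefinite_min_solution B X \<and> (\<forall>Y. indefinite_min_solution B Y \<longrightarrow> op_le (gram X) (gram Y)) \<longleftrightarrow> X = D"
proof (intro iffI conjI allI impI)
  assume X: "indefinite_min_solution B X \<and> (\<forall>Y. indefinite_min_solution B Y \<longrightarrow> op_le (gram X) (gram Y))"
  then have sol: "indefinite_min_solution B X" and bounded_X: "X \<in> bounded_ops"
    by (simp_all add: indefinite_min_solution_iff)
  \<comment> \<open>\<open>D\<close> is itself an ImS, so an optimal \<open>X\<close> may be
    compared with it.\<close>
  have "op_le (gram X) (gram D)"
    using X D by (simp add: indefinite_min_solution_iff)
  then have le: "Re (form (X x) (X x)) \<le> Re (form (D x) (D x))" for x
    using op_le_gram_iff[OF bounded_X D] by blast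
  show "X = D"
  proof
    fix x
    have "Re (form (X x - D x) (X x - D x)) \<le> 0"
      using le[of x] indefinite_min_solution_split(2)[OF sol, of x] by simp
    then have "X x - D x = 0"
      by (rule null_space_definite[OF indefinite_min_solution_split(1)[OF sol]])
    then show "X x = D x" by simp
  qed
next
  assume "X = D"
  then show "indefinite_min_solution B X"
    using D by (simp add: indefinite_min_solution_iff)
  fix Y assume Y: "indefinite_min_solution B Y"
  then have "Y \<in> bounded_ops" by (simp add: indefinite_min_solution_iff)
  moreover have "Re (form (D x) (D x)) \<le> Re (form (Y x) (Y x))" for x
    using indefinite_min_solution_split[OF Y, of x]
      uniformly_positive_nonneg[OF null_space, of "Y x - D x"] by simp
  ultimately show "op_le (gram X) (gram Y)"
    using \<open>X = D\<close> op_le_gram_iff[OF D] by blast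
qed

end

end

text \<open>The first conjunct ensures that the definite description
  \<open>moore_penrose_inverse\<close> in the second denotes a Moore-Penrose inverse.\<close>

theorem theorem6p4:
  fixes cscale :: "complex \<Rightarrow> 'a::ab_group_add \<Rightarrow> 'a"
    and form :: "'a \<Rightarrow> 'a \<Rightarrow> complex"
    and B :: "'a \<Rightarrow> 'a"
  assumes krein: "krein_space cscale form"
    and B: "B \<in> hermitian_space.closed_range_ops cscale form"
    and null_space: "hermitian_space.uniformly_positive cscale form {x. B x = 0}"
    and range: "hermitian_space.uniformly_positive cscale form (range B)"
  shows "(\<exists>!D. hermitian_space.is_moore_penrose_inverse cscale form B D) \<and>
    (\<forall>X0. (hermitian_space.indefinite_min_solution cscale form B X0 \<and>
           (\<forall>Y. hermitian_space.indefinite_min_solution cscale form B Y \<longrightarrow>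
              hermitian_space.op_le form (hermitian_space.gram cscale form X0)
                                         (hermitian_space.gram cscale form Y)))
       \<longleftrightarrow> X0 = hermitian_space.moore_penrose_inverse cscale form B)"
proof -
  interpret krein_space cscale form by (rule krein)
  \<comment> \<open>Any decomposition will do: it serves only to fix a norm, and the conclusion does
    not mention it.\<close>
  obtain P M where PM: "fundamental_decomposition P M"
    using ex_fundamental_decomposition by blast
  interpret uniformly_positive_operator cscale form P M B
    by unfold_locales (rule PM B null_space range)+
  obtain D where "D \<in> bounded_ops"
      "(\<forall>x y. form (B y) (B (D x)) = form (B y) x) \<and> (\<forall>n x. B n = 0 \<longrightarrow> form n (D x) = 0)"
    using least_squares_inverse_exists ..
  then have D: "D \<in> bounded_ops" "\<And>x y. form (B y) (B (D x)) = form (B y) x"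
      "\<And>n x. B n = 0 \<Longrightarrow> form n (D x) = 0"
    by blast+
  have eq: "moore_penrose_inverse B = D"
    by (rule moore_penrose_inverse_eq) (fact D)+
  have inverse: "is_moore_penrose_inverse B D"
    by (rule is_moore_penrose_inverse) (fact D)+
  show ?thesis
    unfolding eq
  proof (intro conjI allI)
    show "\<exists>!D. is_moore_penrose_inverse B D"
      using inverse moore_penrose_inverse_unique[OF bounded _ inverse] by (rule ex1I)
    show "(indefinite_min_solution B X \<and> (\<forall>Y. indefinite_min_solution B Y \<longrightarrow> op_le (gram X) (gram Y)))
        \<longleftrightarrow> X = D" for X
      by (rule minimal_solution_iff) (fact D)+
  qed
qed

end
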